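(* (i) Every inverse limit of an inverse system of finite tree sets is a tree set. (ii) Every profinite tree set is isomorphic to the inverse limit of an inverse system of finite tree sets.
   Context: A separation system $(\vec S,\le,{}^* )$ is a partially ordered set with an order-reversing involution $\vec s\mapsto \vec s^{\,*}=:\overleftarrow s$. Its elements are oriented separations; for $\vec s\in\vec S$ the set $s=\{\vec s,\overleftarrow s\}$ is an (unoriented) separation with orientations $\vec s,\overleftarrow s$, and $S$ denotes the set of unoriented separations. An element $\vec s$ is degenerate if $\vec s=\overleftarrow s$. Two unoriented separations $r,s$ are nested if some orientation of $r$ is $\le$ some orientation of $s$; a separation system is nested if any two of its separations are nested. An oriented separation $\vec r$ is trivial if there is an unoriented separation $s$ with $\vec r<\vec s$ and $\vec r<\overleftarrow s$ (strict inequalities). A tree set is a nested separation system without degenerate and without trivial elements. A homomorphism $f\colon\vec R\to\vec S$ of separation systems is a map with $f(\overleftarrow r)=(f(\vec r))^*$ for all $\vec r$ and $f(\vec r_1)\le f(\vec r_2)$ whenever $\vec r_1\le\vec r_2$; an isomorphism is a bijective homomorphism whose inverse is a homomorphism. An inverse system of finite separation systems consists of a directed poset $P$, finite separation systems $\vec S_p$ ($p\in P$), and homomorphisms $f_{qp}\colon\vec S_q\to\vec S_p$ for $p\le q$ with $f_{pp}=\mathrm{id}$ and $f_{qp}\circ f_{tq}=f_{tp}$ for $p\le q\le t$. Its inverse limit is the set of all families $(\vec s_p)_{p\in P}$ with $\vec s_p\in\vec S_p$ and $f_{qp}(\vec s_q)=\vec s_p$ for all $p\le q$, ordered by $(\vec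 s_p)\le(\vec t_p)$ iff $\vec s_p\le\vec t_p$ for all $p$, with involution $(\vec s_p)^*=(\overleftarrow s_p)$. A separation system is profinite if it is isomorphic to the inverse limit of an inverse system of finite separation systems; a profinite tree set is a tree set which is profinite. *)

theory Defs
  imports Main "HOL-Library.FuncSet"
begin

record 'a sep_system =
  seps :: "'a set"
  sep_le :: "('a \<times> 'a) set"
  sep_inv :: "'a \<Rightarrow> 'a"

definition sep_less :: "'a sep_system \<Rightarrow> 'a \<Rightarrow> 'a \<Rightarrow> bool" where
  "sep_less S r s \<longleftrightarrow> (r, s) \<in> sep_le S \<and> r \<noteq> s"

definition separation_system :: "'a sep_system \<Rightarrow> bool" where
  "separation_system S \<longleftrightarrow>
     partial_order_on (seps S) (sep_le S) \<and>
     sep_inv S \<in> seps S \<rightarrow> seps S \<and>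
     (\<forall>s\<in>seps S. sep_inv S (sep_inv S s) = s) \<and>
     (\<forall>r\<in>seps S. \<forall>s\<in>seps S. (r, s) \<in> sep_le S \<longrightarrow> (sep_inv S s, sep_inv S r) \<in> sep_le S)"

definition unoriented_seps :: "'a sep_system \<Rightarrow> 'a set set" where
  "unoriented_seps S = {{s, sep_inv S s} | s. s \<in> seps S}"

definition nested_seps :: "'a sep_system \<Rightarrow> 'a set \<Rightarrow> 'a set \<Rightarrow> bool" where
  "nested_seps S r s \<longleftrightarrow> (\<exists>x\<in>r. \<exists>y\<in>s. (x, y) \<in> sep_le S)"

definition nested_system :: "'a sep_system \<Rightarrow> bool" where
  "nested_system S \<longleftrightarrow> (\<forall>r\<in>unoriented_seps S. \<forall>s\<in>unoriented_seps S. nested_seps S r s)"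

definition degenerate :: "'a sep_system \<Rightarrow> 'a \<Rightarrow> bool" where
  "degenerate S s \<longleftrightarrow> s = sep_inv S s"

definition trivial_sep :: "'a sep_system \<Rightarrow> 'a \<Rightarrow> bool" where
  "trivial_sep S r \<longleftrightarrow> (\<exists>s\<in>seps S. sep_less S r s \<and> sep_less S r (sep_inv S s))"

definition tree_set :: "'a sep_system \<Rightarrow> bool" where
  "tree_set S \<longleftrightarrow> separation_system S \<and> nested_system S \<and>
     (\<forall>s\<in>seps S. \<not> degenerate S s \<and> \<not> trivial_sep S s)"

definition sep_hom :: "'a sep_system \<Rightarrow> 'b sep_system \<Rightarrow> ('a \<Rightarrow> 'b) \<Rightarrow> bool" where
  "sep_hom R S f \<longleftrightarrow>
     f \<in> seps R \<rightarrow> seps S \<and>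
     (\<forall>r\<in>seps R. f (sep_inv R r) = sep_inv S (f r)) \<and>
     (\<forall>x\<in>seps R. \<forall>y\<in>seps R. (x, y) \<in> sep_le R \<longrightarrow> (f x, f y) \<in> sep_le S)"

definition sep_iso :: "'a sep_system \<Rightarrow> 'b sep_system \<Rightarrow> ('a \<Rightarrow> 'b) \<Rightarrow> bool" where
  "sep_iso R S f \<longleftrightarrow>
     bij_betw f (seps R) (seps S) \<and> sep_hom R S f \<and> sep_hom S R (inv_into (seps R) f)"

definition isomorphic :: "'a sep_system \<Rightarrow> 'b sep_system \<Rightarrow> bool" where
  "isomorphic R S \<longleftrightarrow> (\<exists>f. sep_iso R S f)"

text \<open>Directed posets are nonempty; over an empty index set the inverse limit would be a single
  degenerate separation.\<close>

definition directed_poset :: "'i set \<Rightarrow> ('i \<times> 'i) set \<Rightarrow> bool" where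
  "directed_poset P leP \<longleftrightarrow>
     partial_order_on P leP \<and> P \<noteq> {} \<and>
     (\<forall>p\<in>P. \<forall>q\<in>P. \<exists>t\<in>P. (p, t) \<in> leP \<and> (q, t) \<in> leP)"

text \<open>The map \<open>f q p\<close> goes from \<open>D q\<close> to \<open>D p\<close>, for \<open>(p, q) \<in> leP\<close>.\<close>

definition inverse_system ::
  "'i set \<Rightarrow> ('i \<times> 'i) set \<Rightarrow> ('i \<Rightarrow> 'b sep_system) \<Rightarrow> ('i \<Rightarrow> 'i \<Rightarrow> 'b \<Rightarrow> 'b) \<Rightarrow> bool" where
  "inverse_system P leP D f \<longleftrightarrow>
     directed_poset P leP \<and>
     (\<forall>p\<in>P. separation_system (D p)) \<and>
     (\<forall>p q. (p, q) \<in> leP \<longrightarrow> sep_hom (D q) (D p) (f q p)) \<and>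
     (\<forall>p\<in>P. \<forall>s\<in>seps (D p). f p p s = s) \<and>
     (\<forall>p q t. (p, q) \<in> leP \<and> (q, t) \<in> leP \<longrightarrow> (\<forall>s\<in>seps (D t). f q p (f t q s) = f t p s))"

definition compatible_families ::
  "'i set \<Rightarrow> ('i \<times> 'i) set \<Rightarrow> ('i \<Rightarrow> 'b sep_system) \<Rightarrow> ('i \<Rightarrow> 'i \<Rightarrow> 'b \<Rightarrow> 'b) \<Rightarrow> ('i \<Rightarrow> 'b) set" where
  "compatible_families P leP D f =
     {s \<in> (\<Pi>\<^sub>E p\<in>P. seps (D p)). \<forall>p q. (p, q) \<in> leP \<longrightarrow> f q p (s q) = s p}"

definition inverse_limit ::
  "'i set \<Rightarrow> ('i \<times> 'i) set \<Rightarrow> ('i \<Rightarrow> 'b sep_system) \<Rightarrow> ('i \<Rightarrow> 'i \<Rightarrow> 'b \<Rightarrow> 'b)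
     \<Rightarrow> ('i \<Rightarrow> 'b) sep_system" where
  "inverse_limit P leP D f =
     \<lparr> seps = compatible_families P leP D f,
       sep_le = {(s, t). s \<in> compatible_families P leP D f \<and> t \<in> compatible_families P leP D f \<and>
                         (\<forall>p\<in>P. (s p, t p) \<in> sep_le (D p))},
       sep_inv = (\<lambda>s. \<lambda>p\<in>P. sep_inv (D p) (s p)) \<rparr>"

text \<open>HOL cannot quantify over types inside a formula, so the type of the indices and the common
  type of the elements of the finite systems are parameters of the notion of profiniteness. As a
  hypothesis it is used with both types arbitrary.

  Where an inverse system of finite systems with limit isomorphic to a given \<open>S :: 'a sep_system\<close>
  is asserted to exist, it can without loss of generality be taken with indices of type
  \<open>('a \<times> 'a) set\<close> and elements of type \<open>'a set\<close>. Given any such system and the induced maps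
  \<open>h p\<close> from \<open>S\<close> to \<open>D p\<close>, restrict every \<open>D p\<close> to the image of \<open>h p\<close> (which leaves the limit
  unchanged and preserves being a tree set), replace \<open>p\<close> by the preorder
  \<open>{(x, y). (h p x, h p y) \<in> sep_le (D p)}\<close> on \<open>seps S\<close>, ordering these by reverse inclusion,
  and replace the elements of the image of \<open>h p\<close> by their preimages in \<open>seps S\<close>.\<close>

definition profinite :: "'i itself \<Rightarrow> 'b itself \<Rightarrow> 'a sep_system \<Rightarrow> bool" where
  "profinite TI TB S \<longleftrightarrow>
     separation_system S \<and>
     (\<exists>(P :: 'i set) leP (D :: 'i \<Rightarrow> 'b sep_system) f.
        inverse_system P leP D f \<and> (\<forall>p\<in>P. finite (seps (D p))) \<and>
        isomorphic S (inverse_limit P leP D f))"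

end

theory Submission
  imports Defs "HOL-Analysis.Function_Topology"
begin

text \<open>Since the index poset is directed, nestedness, non-degeneracy and non-triviality of an inverse
  limit can each be decided in a single finite tree set, which gives (i).

  For (ii), regard the finite quotients of a profinite tree set \<open>T\<close> as preorders on \<open>T\<close>. By
  compactness, all degeneracies of these quotients vanish from some level on, and all remaining
  trivialities are eventually witnessed by small or co-small separations only, because anything
  surviving at all levels would be degenerate or trivial in \<open>T\<close>. Collapsing the separations that
  are small at such a level to leaves yields finite tree set quotients of \<open>T\<close> that are cofinal
  among all its given finite quotients, so that \<open>T\<close> is also their inverse limit.\<close>

section \<open>Inverse limits\<close>

text \<open>Call \<open>s\<close> small if it lies below its own inverse. Finite quotients of a tree
  set may well contain degenerate and trivial elements. Degeneracy is a closed condition and dies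
  out by compactness. Triviality is not closed: it asks for strict inequalities, and in the limit a
  witness may become equal to the trivial element or to its inverse. The witness is then small or
  co-small, which a tree set permits. Trivial elements close to small ones may therefore survive in
  every given quotient, and passing to a subsystem does not suffice.

  The repair rests on the fact that small elements of a tree set are minimal: anything strictly
  below a small element would be trivial. Cutting all relations below small elements thus loses
  nothing in the limit, provided the precision is controlled from both sides. Preorders on one fixed
  carrier make this control a matter of inclusion: a tree quotient is squeezed between a given level
  and a finer one. They also provide the types of the indices and of the elements in the
  conclusion.\<close>

lemma separation_systemD:
  assumes "separation_system S"
  shows sep_le_carrier: "(x, y) \<in> sep_le S \<Longrightarrow> x \<in> seps S \<and> y \<in> seps S"
    and sep_le_refl: "x \<in> seps S \<Longrightarrow> (x, x) \<in> sep_le S"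
    and sep_le_trans: "(x, y) \<in> sep_le S \<Longrightarrow> (y, z) \<in> sep_le S \<Longrightarrow> (x, z) \<in> sep_le S"
    and sep_le_antisym: "(x, y) \<in> sep_le S \<Longrightarrow> (y, x) \<in> sep_le S \<Longrightarrow> x = y"
    and sep_inv_carrier: "x \<in> seps S \<Longrightarrow> sep_inv S x \<in> seps S"
    and sep_inv_inv: "x \<in> seps S \<Longrightarrow> sep_inv S (sep_inv S x) = x"
    and sep_le_inv: "(x, y) \<in> sep_le S \<Longrightarrow> (sep_inv S y, sep_inv S x) \<in> sep_le S"
  using assms
  by (auto simp: separation_system_def partial_order_on_def preorder_on_def
      dest: refl_onD transD antisymD)

lemma directed_posetD:
  assumes "directed_poset P leP"
  shows directed_poset_carrier: "(p, q) \<in> leP \<Longrightarrow> p \<in> P \<and> q \<in> P"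
    and directed_poset_refl: "p \<in> P \<Longrightarrow> (p, p) \<in> leP"
    and directed_poset_trans: "(p, q) \<in> leP \<Longrightarrow> (q, t) \<in> leP \<Longrightarrow> (p, t) \<in> leP"
    and directed_poset_ub: "p \<in> P \<Longrightarrow> q \<in> P \<Longrightarrow> \<exists>t. (p, t) \<in> leP \<and> (q, t) \<in> leP"
  using assms unfolding directed_poset_def partial_order_on_def preorder_on_def refl_on_def
  by (blast dest: transD)+

lemma inverse_limit_simps [simp]:
  "seps (inverse_limit P leP D f) = compatible_families P leP D f"
  "(s, t) \<in> sep_le (inverse_limit P leP D f) \<longleftrightarrow>
     s \<in> compatible_families P leP D f \<and> t \<in> compatible_families P leP D f \<and>
     (\<forall>p\<in>P. (s p, t p) \<in> sep_le (D p))"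
  "sep_inv (inverse_limit P leP D f) s = (\<lambda>p\<in>P. sep_inv (D p) (s p))"
  by (auto simp: inverse_limit_def)

lemma compatible_families_eqI:
  assumes "s \<in> compatible_families P leP D f" "t \<in> compatible_families P leP D f"
    and "\<And>p. p \<in> P \<Longrightarrow> s p = t p"
  shows "s = t"
  using assms by (auto simp: compatible_families_def intro: PiE_ext)

lemma nested_system_iff:
  "nested_system S \<longleftrightarrow> (\<forall>r\<in>seps S. \<forall>s\<in>seps S.
    (r, s) \<in> sep_le S \<or> (r, sep_inv S s) \<in> sep_le S \<or>
    (sep_inv S r, s) \<in> sep_le S \<or> (sep_inv S r, sep_inv S s) \<in> sep_le S)"
proof -
  have "nested_system S \<longleftrightarrow>
      (\<forall>r\<in>seps S. \<forall>s\<in>seps S. nested_seps S {r, sep_inv S r} {s, sep_inv S s})"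
    unfolding nested_system_def unoriented_seps_def by blast
  then show ?thesis by (auto simp: nested_seps_def)
qed

text \<open>Non-triviality is put into a form without strict inequalities, so that it can be applied
  to limit points, where strictness may be lost.\<close>

lemma tree_set_iff:
  "tree_set S \<longleftrightarrow> separation_system S \<and>
    (\<forall>r\<in>seps S. \<forall>s\<in>seps S.
      (r, s) \<in> sep_le S \<or> (r, sep_inv S s) \<in> sep_le S \<or>
      (sep_inv S r, s) \<in> sep_le S \<or> (sep_inv S r, sep_inv S s) \<in> sep_le S) \<and>
    (\<forall>r\<in>seps S. r \<noteq> sep_inv S r) \<and>
    (\<forall>r\<in>seps S. \<forall>s\<in>seps S. (r, s) \<in> sep_le S \<longrightarrow> (r, sep_inv S s) \<in> sep_le S \<longrightarrow>
      r = s \<or> r = sep_inv S s)"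
  unfolding tree_set_def nested_system_iff degenerate_def trivial_sep_def sep_less_def by blast

lemma inverse_limit_separation_system:
  assumes "inverse_system P leP D f"
  shows "separation_system (inverse_limit P leP D f)"
proof -
  let ?L = "inverse_limit P leP D f" and ?C = "compatible_families P leP D f"
  have P: "directed_poset P leP" and D: "\<And>p. p \<in> P \<Longrightarrow> separation_system (D p)"
    and f: "\<And>p q. (p, q) \<in> leP \<Longrightarrow> sep_hom (D q) (D p) (f q p)"
    using assms by (auto simp: inverse_system_def)
  have mem: "s p \<in> seps (D p)" if "s \<in> ?C" "p \<in> P" for s p
    using that by (auto simp: compatible_families_def)
  have inv: "(\<lambda>p\<in>P. sep_inv (D p) (s p)) \<in> ?C" if s: "s \<in> ?C" for s
  proof -
    have "f q p (sep_inv (D q) (s q)) = sep_inv (D p) (s p)" if "(p, q) \<in> leP" for p q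
      using f[OF that] directed_poset_carrier[OF P that] mem[OF s] s that
      by (auto simp: sep_hom_def compatible_families_def)
    then show ?thesis
      using sep_inv_carrier[OF D mem[OF s]] directed_poset_carrier[OF P]
      by (auto simp: compatible_families_def)
  qed
  have le: "(s, t) \<in> sep_le ?L \<longleftrightarrow> s \<in> ?C \<and> t \<in> ?C \<and> (\<forall>p\<in>P. (s p, t p) \<in> sep_le (D p))" for s t
    by simp
  have "refl_on ?C (sep_le ?L)"
    unfolding refl_on_def le using sep_le_refl[OF D mem] by blast
  moreover have "trans (sep_le ?L)"
    unfolding trans_def le using sep_le_trans[OF D] by blast
  moreover have "antisym (sep_le ?L)"
    unfolding antisym_def le
    by (blast intro: compatible_families_eqI sep_le_antisym[OF D])
  moreover have "sep_inv ?L (sep_inv ?L s) = s" if "s \<in> ?C" for s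
  proof (rule compatible_families_eqI)
    show "sep_inv ?L (sep_inv ?L s) \<in> ?C" using inv[OF inv[OF that]] by simp
    show "sep_inv ?L (sep_inv ?L s) p = s p" if "p \<in> P" for p
      using sep_inv_inv[OF D mem[OF \<open>s \<in> ?C\<close>]] that by simp
  qed (rule that)
  moreover have "(sep_inv ?L t, sep_inv ?L s) \<in> sep_le ?L" if "(s, t) \<in> sep_le ?L" for s t
    using that inv sep_le_inv[OF D] by simp
  moreover have "sep_le ?L \<subseteq> ?C \<times> ?C" by auto
  moreover have "sep_inv ?L \<in> ?C \<rightarrow> ?C" using inv by auto
  ultimately show ?thesis
    unfolding separation_system_def partial_order_on_def preorder_on_def inverse_limit_simps(1)
    by (intro conjI ballI impI) assumption+
qed

lemma inverse_limit_tree_set: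
  assumes sys: "inverse_system P leP D f" and tree: "\<And>p. p \<in> P \<Longrightarrow> tree_set (D p)"
  shows "tree_set (inverse_limit P leP D f)"
proof -
  let ?L = "inverse_limit P leP D f" and ?C = "compatible_families P leP D f"
  have P: "directed_poset P leP"
    and f: "\<And>p q. (p, q) \<in> leP \<Longrightarrow> sep_hom (D q) (D p) (f q p)"
    using sys by (auto simp: inverse_system_def)
  have mem: "s p \<in> seps (D p)" if "s \<in> ?C" "p \<in> P" for s p
    using that by (auto simp: compatible_families_def)
  have step: "s p = f q p (s q)" if "s \<in> ?C" "(p, q) \<in> leP" for s p q
    using that by (auto simp: compatible_families_def)
  have lim: "separation_system ?L" using inverse_limit_separation_system[OF sys] .
  have inv: "sep_inv ?L s \<in> ?C" if "s \<in> ?C" for s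
    using sep_inv_carrier[OF lim] that by simp
  \<comment> \<open>Relations descend along the bonding maps, so a relation that fails at one index
    fails at all later ones. This allows the four failures below to be collected at a single
    index.\<close>
  have down: "(s p, t p) \<in> sep_le (D p)"
    if "s \<in> ?C" "t \<in> ?C" "(p, q) \<in> leP" "(s q, t q) \<in> sep_le (D q)" for s t p q
    using that(4) f[OF that(3)] mem[OF that(1)] mem[OF that(2)] directed_poset_carrier[OF P that(3)]
    unfolding step[OF that(1,3)] step[OF that(2,3)] sep_hom_def by blast
  have nested: "(r, s) \<in> sep_le ?L \<or> (r, sep_inv ?L s) \<in> sep_le ?L \<or>
      (sep_inv ?L r, s) \<in> sep_le ?L \<or> (sep_inv ?L r, sep_inv ?L s) \<in> sep_le ?L"
    if r: "r \<in> ?C" and s: "s \<in> ?C" for r s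
  proof (rule ccontr)
    have fails: "\<exists>p\<in>P. (x p, y p) \<notin> sep_le (D p)"
      if "(x, y) \<notin> sep_le ?L" "x \<in> ?C" "y \<in> ?C" for x y using that by simp
    assume contra: "\<not> ?thesis"
    obtain p1 p2 p3 p4 where p: "p1 \<in> P" "p2 \<in> P" "p3 \<in> P" "p4 \<in> P"
      and no: "(r p1, s p1) \<notin> sep_le (D p1)" "(r p2, sep_inv ?L s p2) \<notin> sep_le (D p2)"
        "(sep_inv ?L r p3, s p3) \<notin> sep_le (D p3)"
        "(sep_inv ?L r p4, sep_inv ?L s p4) \<notin> sep_le (D p4)"
      using contra fails[OF _ r s] fails[OF _ r inv[OF s]] fails[OF _ inv[OF r] s]
        fails[OF _ inv[OF r] inv[OF s]] by blast
    obtain a where a: "(p1, a) \<in> leP" "(p2, a) \<in> leP"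
      using directed_poset_ub[OF P p(1,2)] by blast
    obtain b where b: "(p3, b) \<in> leP" "(p4, b) \<in> leP"
      using directed_poset_ub[OF P p(3,4)] by blast
    have ab: "a \<in> P" "b \<in> P" using a b directed_poset_carrier[OF P] by blast+
    obtain q where q: "(a, q) \<in> leP" "(b, q) \<in> leP"
      using directed_poset_ub[OF P ab] by blast
    have q': "(p1, q) \<in> leP" "(p2, q) \<in> leP" "(p3, q) \<in> leP" "(p4, q) \<in> leP"
      using a b q directed_poset_trans[OF P] by blast+
    have qP: "q \<in> P" using directed_poset_carrier[OF P q(1)] by simp
    have "(r q, s q) \<in> sep_le (D q) \<or> (r q, sep_inv ?L s q) \<in> sep_le (D q) \<or>
      (sep_inv ?L r q, s q) \<in> sep_le (D q) \<or> (sep_inv ?L r q, sep_inv ?L s q) \<in> sep_le (D q)"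
      using tree[OF qP] mem[OF r qP] mem[OF s qP] qP by (simp add: tree_set_iff)
    then show False
      using no down[OF r s q'(1)] down[OF r inv[OF s] q'(2)] down[OF inv[OF r] s q'(3)]
        down[OF inv[OF r] inv[OF s] q'(4)] by blast
  qed
  have nondeg: "r \<noteq> sep_inv ?L r" if "r \<in> ?C" for r
  proof
    assume eq: "r = sep_inv ?L r"
    obtain p where p: "p \<in> P" using P by (auto simp: directed_poset_def)
    have "sep_inv ?L r p = sep_inv (D p) (r p)" using p by simp
    then have "r p = sep_inv (D p) (r p)" using fun_cong[OF eq, of p] by (rule trans[rotated])
    then show False using tree[OF p] mem[OF that p] unfolding tree_set_iff by blast
  qed
  have nontriv: "r = s \<or> r = sep_inv ?L s"
    if le: "(r, s) \<in> sep_le ?L" "(r, sep_inv ?L s) \<in> sep_le ?L" for r s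
  proof (rule ccontr)
    have r: "r \<in> ?C" and s: "s \<in> ?C" using le by auto
    assume "\<not> ?thesis"
    then obtain p q where p: "p \<in> P" "r p \<noteq> s p" and q: "q \<in> P" "r q \<noteq> sep_inv ?L s q"
      using compatible_families_eqI[OF r s] compatible_families_eqI[OF r inv[OF s]] by blast
    obtain t where t: "(p, t) \<in> leP" "(q, t) \<in> leP"
      using directed_poset_ub[OF P p(1) q(1)] by blast
    have tP: "t \<in> P" using directed_poset_carrier[OF P t(1)] by simp
    \<comment> \<open>A bonding map cannot separate equal entries, so differences persist at later
      indices.\<close>
    have "r t \<noteq> s t" using p step[OF r t(1)] step[OF s t(1)] by metis
    moreover have "r t \<noteq> sep_inv ?L s t"
      using q step[OF r t(2)] step[OF inv[OF s] t(2)] by metis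
    moreover have "(r t, s t) \<in> sep_le (D t)" "(r t, sep_inv (D t) (s t)) \<in> sep_le (D t)"
      using le tP by auto
    moreover have "sep_inv ?L s t = sep_inv (D t) (s t)" using tP by simp
    ultimately show False
      using tree[OF tP] mem[OF r tP] mem[OF s tP] unfolding tree_set_iff by metis
  qed
  show ?thesis
    unfolding tree_set_iff inverse_limit_simps(1)
    by (intro conjI ballI impI lim nested nondeg nontriv)
qed

text \<open>Tychonoff's theorem for finite discrete spaces: the compatible families form the
  intersection of a directed family of nonempty closed subsets of a compact product.\<close>

lemma finite_inverse_limit_nonempty:
  fixes X :: "'i \<Rightarrow> 'b set"
  assumes P: "directed_poset P leP"
    and X: "\<And>p. p \<in> P \<Longrightarrow> finite (X p)" "\<And>p. p \<in> P \<Longrightarrow> X p \<noteq> {}"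
    and f: "\<And>p q x. (p, q) \<in> leP \<Longrightarrow> x \<in> X q \<Longrightarrow> f q p x \<in> X p"
    and comp: "\<And>p q t x. (p, q) \<in> leP \<Longrightarrow> (q, t) \<in> leP \<Longrightarrow> x \<in> X t \<Longrightarrow> f q p (f t q x) = f t p x"
  obtains x where "x \<in> Pi\<^sub>E P X" "\<And>p q. (p, q) \<in> leP \<Longrightarrow> f q p (x q) = x p"
proof -
  have le: "p \<in> P" "q \<in> P" if "(p, q) \<in> leP" for p q
    using directed_poset_carrier[OF P that] by auto
  note refl = directed_poset_refl[OF P] and trans = directed_poset_trans[OF P]
  define Y where "Y = product_topology (\<lambda>p. discrete_topology (X p)) P"
  have top: "topspace Y = Pi\<^sub>E P X" by (simp add: Y_def)
  \<comment> \<open>Only relations between \<open>t\<close> and the indices below it are imposed, so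
    that a single element of \<open>X t\<close> suffices to build a member of
    \<open>K t\<close>.\<close>
  define K where "K t = {z \<in> Pi\<^sub>E P X. \<forall>r. (r, t) \<in> leP \<longrightarrow> f t r (z t) = z r}" for t
  have compact: "compact_space Y"
    unfolding Y_def compact_space_product_topology compact_space_discrete_topology using X by blast
  have coord: "closedin Y {z \<in> Pi\<^sub>E P X. z p \<in> B}" if "p \<in> P" for p B
  proof -
    have "continuous_map Y (discrete_topology (X p)) (\<lambda>z. z p)"
      unfolding Y_def using that by (rule continuous_map_product_projection)
    then have "closedin Y {z \<in> topspace Y. z p \<in> B \<inter> X p}"
      by (rule closedin_continuous_map_preimage) simp
    moreover have "{z \<in> topspace Y. z p \<in> B \<inter> X p} = {z \<in> Pi\<^sub>E P X. z p \<in> B}"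
      using that by (auto simp: top)
    ultimately show ?thesis by simp
  qed
  have closed: "closedin Y (K t)" if t: "t \<in> P" for t
  proof -
    have "closedin Y {z \<in> Pi\<^sub>E P X. f t r (z t) = z r}" if r: "(r, t) \<in> leP" for r
    proof -
      \<comment> \<open>As \<open>X t\<close> is finite, splitting by the value of
        \<open>z t\<close> gives a finite union of sets that each prescribe two coordinates.\<close>
      have "{z \<in> Pi\<^sub>E P X. f t r (z t) = z r}
          = (\<Union>a\<in>X t. {z \<in> Pi\<^sub>E P X. z t \<in> {a}} \<inter> {z \<in> Pi\<^sub>E P X. z r \<in> {f t r a}})"
        using t by (auto simp: PiE_mem)
      also have "closedin Y \<dots>"
      proof (rule closedin_Union)
        show "closedin Y A" if "A \<in> (\<lambda>a. {z \<in> Pi\<^sub>E P X. z t \<in> {a}} \<inter> {z \<in> Pi\<^sub>E P X. z r \<in> {f t r a}}) ` X t"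
          for A using that closedin_Int[OF coord[OF t] coord[OF le(1)[OF r]]] by blast
      qed (use X(1)[OF t] in simp)
      finally show ?thesis .
    qed
    moreover have "K t = (\<Inter>r\<in>{r. (r, t) \<in> leP}. {z \<in> Pi\<^sub>E P X. f t r (z t) = z r})"
      using refl[OF t] by (auto simp: K_def)
    ultimately show ?thesis
      using refl[OF t] by (auto intro!: closedin_Inter)
  qed
  have nonempty: "K t \<noteq> {}" if t: "t \<in> P" for t
  proof -
    obtain a where a: "a \<in> X t" using X(2)[OF t] by blast
    \<comment> \<open>Coordinates below \<open>t\<close> are images of \<open>a\<close>; the others
      are unconstrained and may be chosen arbitrarily.\<close>
    define z where "z = (\<lambda>r\<in>P. if (r, t) \<in> leP then f t r a else (SOME b. b \<in> X r))"
    have "z \<in> Pi\<^sub>E P X"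
      using X(2) f a by (auto simp: z_def some_in_eq)
    moreover have "f t r (z t) = z r" if "(r, t) \<in> leP" for r
      using comp[OF that refl[OF t] a] that t refl[OF t] le[OF that] by (simp add: z_def)
    ultimately show ?thesis by (auto simp: K_def)
  qed
  have mono: "K t \<subseteq> K q" if qt: "(q, t) \<in> leP" for q t
  proof
    fix z assume z: "z \<in> K t"
    have "f q r (z q) = z r" if rq: "(r, q) \<in> leP" for r
    proof -
      have "z t \<in> X t" using z le[OF qt] by (auto simp: K_def)
      then have "f q r (f t q (z t)) = f t r (z t)" using comp rq qt by blast
      then show ?thesis using z qt trans[OF rq qt] by (simp add: K_def)
    qed
    then show "z \<in> K q" using z by (auto simp: K_def)
  qed
  have directed: "\<exists>t\<in>P. K t \<subseteq> \<Inter>\<F>" if "finite \<F>" "\<F> \<subseteq> K ` P" for \<F>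
    using that
  proof (induction \<F>)
    case empty
    then show ?case using P by (auto simp: directed_poset_def)
  next
    case (insert A \<F>)
    then obtain t q where t: "t \<in> P" "K t \<subseteq> \<Inter>\<F>" and q: "q \<in> P" "A = K q" by auto
    obtain u where u: "u \<in> P" "(t, u) \<in> leP" "(q, u) \<in> leP"
      using P t q unfolding directed_poset_def by blast
    have "K u \<subseteq> \<Inter>(insert A \<F>)" using mono[OF u(2)] mono[OF u(3)] t q by auto
    then show ?case using u(1) by blast
  qed
  have "\<Inter>(K ` P) \<noteq> {}"
  proof -
    have "\<forall>C\<in>K ` P. closedin Y C" using closed by blast
    moreover have "\<Inter>\<F> \<noteq> {}" if "finite \<F>" "\<F> \<subseteq> K ` P" for \<F>
      using directed[OF that] nonempty by fastforce
    ultimately show ?thesis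
      using compact[unfolded compact_space_fip, rule_format, of "K ` P"] by blast
  qed
  then obtain z where z: "\<And>p. p \<in> P \<Longrightarrow> z \<in> K p" by auto
  show thesis
  proof
    show "z \<in> Pi\<^sub>E P X" using z P by (auto simp: directed_poset_def K_def)
    show "f q p (z q) = z p" if "(p, q) \<in> leP" for p q
      using z[OF le(2)[OF that]] that by (simp add: K_def)
  qed
qed

section \<open>Families of finite quotients\<close>

definition sep_preorder :: "'a sep_system \<Rightarrow> 'a rel \<Rightarrow> bool" where
  "sep_preorder S R \<longleftrightarrow> R \<subseteq> seps S \<times> seps S \<and> sep_le S \<subseteq> R \<and> trans R \<and>
     (\<forall>(x, y)\<in>R. (sep_inv S y, sep_inv S x) \<in> R)"

text \<open>For a preorder this is the kernel of the quotient map that it encodes.\<close>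

definition sym_part :: "'a rel \<Rightarrow> 'a rel" where
  "sym_part R = R \<inter> R\<inverse>"

lemma sym_part_iff: "(x, y) \<in> sym_part R \<longleftrightarrow> (x, y) \<in> R \<and> (y, x) \<in> R"
  by (auto simp: sym_part_def)

lemma sym_part_mono: "R \<subseteq> R' \<Longrightarrow> sym_part R \<subseteq> sym_part R'"
  by (auto simp: sym_part_def)

lemma sep_preorderD:
  assumes "sep_preorder S R"
  shows sep_preorder_carrier: "(x, y) \<in> R \<Longrightarrow> x \<in> seps S \<and> y \<in> seps S"
    and sep_preorder_le: "(x, y) \<in> sep_le S \<Longrightarrow> (x, y) \<in> R"
    and sep_preorder_trans: "(x, y) \<in> R \<Longrightarrow> (y, z) \<in> R \<Longrightarrow> (x, z) \<in> R"
    and sep_preorder_inv: "(x, y) \<in> R \<Longrightarrow> (sep_inv S y, sep_inv S x) \<in> R"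
  using assms by (auto simp: sep_preorder_def dest: transD)

lemma sep_preorder_refl:
  assumes "separation_system S" "sep_preorder S R" "x \<in> seps S"
  shows "(x, x) \<in> R"
  using assms sep_le_refl sep_preorder_le by metis

lemma sep_preorder_sym_part_equiv:
  assumes "separation_system S" "sep_preorder S R"
  shows "equiv (seps S) (sym_part R)"
proof (rule equivI)
  show "sym_part R \<subseteq> seps S \<times> seps S"
    using sep_preorder_carrier[OF assms(2)] by (auto simp: sym_part_iff)
  show "refl_on (seps S) (sym_part R)"
    using sep_preorder_refl[OF assms] by (auto simp: refl_on_def sym_part_iff)
  show "sym (sym_part R)" by (auto simp: sym_def sym_part_iff)
  show "trans (sym_part R)"
    using sep_preorder_trans[OF assms(2)] unfolding trans_def sym_part_iff by blast
qed

text \<open>Saturation under \<open>s\<close> will serve as the bonding map from a finer quotient to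
  a coarser one; this computes it on classes.\<close>

lemma Image_class_coarser:
  assumes "equiv A r" "trans s" "r \<subseteq> s" "x \<in> A"
  shows "s `` (r `` {x}) = s `` {x}"
proof -
  have "(x, x) \<in> r" using assms(1,4) by (auto simp: equiv_def refl_on_def)
  then show ?thesis using assms(3) transD[OF assms(2)] by blast
qed

lemma finite_quotient_coarser:
  assumes "equiv A r" "equiv A s" "r \<subseteq> s" "finite (A // r)"
  shows "finite (A // s)"
proof -
  have "s `` {x} = s `` (r `` {x})" if "x \<in> A" for x
    using Image_class_coarser[OF assms(1) _ assms(3) that] assms(2) by (simp add: equiv_def)
  then have "A // s \<subseteq> (\<lambda>C. s `` C) ` (A // r)"
    unfolding quotient_def by blast
  then show ?thesis using assms(4) finite_surj by blast
qed

text \<open>The finite quotients of \<open>S\<close> are encoded by the preorders on \<open>S\<close> that they induce, and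
  \<open>complete\<close> says that \<open>S\<close> is the whole inverse limit of these quotients.\<close>

locale quotient_family =
  fixes S :: "'a sep_system" and \<L> :: "'a rel set"
  assumes sep: "separation_system S"
    and family_nonempty: "\<L> \<noteq> {}"
    and preorder: "L \<in> \<L> \<Longrightarrow> sep_preorder S L"
    and fin: "L \<in> \<L> \<Longrightarrow> finite (seps S // sym_part L)"
    and directed: "L \<in> \<L> \<Longrightarrow> L' \<in> \<L> \<Longrightarrow> \<exists>M\<in>\<L>. M \<subseteq> L \<and> M \<subseteq> L'"
    and separating: "x \<in> seps S \<Longrightarrow> y \<in> seps S \<Longrightarrow> (\<And>L. L \<in> \<L> \<Longrightarrow> (x, y) \<in> L) \<Longrightarrow> (x, y) \<in> sep_le S"
    and complete: "(\<And>L. L \<in> \<L> \<Longrightarrow> c L \<in> seps S) \<Longrightarrow>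
      (\<And>L M. L \<in> \<L> \<Longrightarrow> M \<in> \<L> \<Longrightarrow> M \<subseteq> L \<Longrightarrow> (c M, c L) \<in> sym_part L) \<Longrightarrow>
      \<exists>x\<in>seps S. \<forall>L\<in>\<L>. (x, c L) \<in> sym_part L"
begin

lemma equiv: "L \<in> \<L> \<Longrightarrow> equiv (seps S) (sym_part L)"
  using sep_preorder_sym_part_equiv[OF sep preorder] .

lemma directed_poset_reverse_inclusion:
  "directed_poset \<L> {(L, M). L \<in> \<L> \<and> M \<in> \<L> \<and> M \<subseteq> L}"
  using family_nonempty directed
  by (auto simp: directed_poset_def partial_order_on_def preorder_on_def refl_on_def trans_def
      antisym_def)

text \<open>Any choice of representatives from such classes is coherent in the sense of
  \<open>complete\<close>, and the element so obtained lies in every class.\<close>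

lemma complete_classes:
  assumes C: "\<And>L. L \<in> \<L> \<Longrightarrow> C L \<in> seps S // sym_part L"
    and mono: "\<And>L M. L \<in> \<L> \<Longrightarrow> M \<in> \<L> \<Longrightarrow> M \<subseteq> L \<Longrightarrow> C M \<subseteq> C L"
  obtains x where "x \<in> seps S" "\<And>L. L \<in> \<L> \<Longrightarrow> C L = sym_part L `` {x}"
proof -
  define c where "c L = (SOME x. x \<in> C L)" for L
  have c: "c L \<in> C L" if "L \<in> \<L>" for L
    unfolding c_def some_in_eq using C[OF that] in_quotient_imp_non_empty[OF equiv[OF that]] by blast
  have "\<exists>x\<in>seps S. \<forall>L\<in>\<L>. (x, c L) \<in> sym_part L"
  proof (rule complete)
    show "c L \<in> seps S" if "L \<in> \<L>" for L
      using c C in_quotient_imp_subset[OF equiv] that by blast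
    show "(c M, c L) \<in> sym_part L" if "L \<in> \<L>" "M \<in> \<L>" "M \<subseteq> L" for L M
      using quotient_eq_iff[OF equiv[OF that(1)] C[OF that(1)] C[OF that(1)]] c mono that by blast
  qed
  then obtain x where x: "x \<in> seps S" "\<And>L. L \<in> \<L> \<Longrightarrow> (x, c L) \<in> sym_part L" by blast
  show thesis
  proof
    show "C L = sym_part L `` {x}" if L: "L \<in> \<L>" for L
    proof -
      obtain y where y: "C L = sym_part L `` {y}" "y \<in> seps S" using C[OF L] by (auto elim: quotientE)
      then have "(y, c L) \<in> sym_part L" using c[OF L] by blast
      then show ?thesis using y x(2)[OF L] equiv_class_eq_iff[OF equiv[OF L]] by metis
    qed
  qed (rule x(1))
qed

text \<open>The pairs of classes met by \<open>E L\<close> form an inverse system of finite nonempty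
  sets, and completeness turns a thread of it into a pair of elements. Saturation brings
  \<open>E L\<close> from representatives to this pair. It is demanded only modulo some level
  \<open>M\<close>, because the relations used later also refer to a second, fixed level.\<close>

lemma compactness:
  assumes inhabited: "\<And>L. L \<in> \<L> \<Longrightarrow> \<exists>x\<in>seps S. \<exists>y\<in>seps S. E L x y"
    and mono: "\<And>L M x y. L \<in> \<L> \<Longrightarrow> M \<in> \<L> \<Longrightarrow> M \<subseteq> L \<Longrightarrow> E M x y \<Longrightarrow> E L x y"
    and saturated: "\<And>L. L \<in> \<L> \<Longrightarrow> \<exists>M\<in>\<L>. \<forall>x y x' y'.
      E L x y \<longrightarrow> (x, x') \<in> sym_part M \<longrightarrow> (y, y') \<in> sym_part M \<longrightarrow> E L x' y'"
  shows "\<exists>x\<in>seps S. \<exists>y\<in>seps S. \<forall>L\<in>\<L>. E L x y"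
proof -
  define X where "X L = {(sym_part L `` {x}, sym_part L `` {y}) | x y. x \<in> seps S \<and> y \<in> seps S \<and> E L x y}" for L
  define f where "f (M :: 'a rel) (L :: 'a rel) = map_prod ((``) (sym_part L)) ((``) (sym_part L))" for M L
  have coarsen: "sym_part L `` (sym_part M `` {x}) = sym_part L `` {x}"
    if "L \<in> \<L>" "M \<in> \<L>" "M \<subseteq> L" "x \<in> seps S" for L M x
    by (rule Image_class_coarser[OF equiv[OF that(2)] _ sym_part_mono[OF that(3)] that(4)])
      (use equiv[OF that(1)] in \<open>simp add: equiv_def\<close>)
  have XQ: "X L \<subseteq> (seps S // sym_part L) \<times> (seps S // sym_part L)" for L
    by (auto simp: X_def quotientI)
  obtain z where z: "z \<in> Pi\<^sub>E \<L> X"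
    and comp: "\<And>L M. (L, M) \<in> {(L, M). L \<in> \<L> \<and> M \<in> \<L> \<and> M \<subseteq> L} \<Longrightarrow> f M L (z M) = z L"
  proof (rule finite_inverse_limit_nonempty[OF directed_poset_reverse_inclusion, of X f])
    show "finite (X L)" if "L \<in> \<L>" for L
      using finite_subset[OF XQ] fin[OF that] by blast
    show "X L \<noteq> {}" if "L \<in> \<L>" for L
      using inhabited[OF that] by (auto simp: X_def)
    show "f M L e \<in> X L" if LM: "(L, M) \<in> {(L, M). L \<in> \<L> \<and> M \<in> \<L> \<and> M \<subseteq> L}" and e: "e \<in> X M" for L M e
    proof -
      obtain x y where "e = (sym_part M `` {x}, sym_part M `` {y})" "x \<in> seps S" "y \<in> seps S" "E M x y"
        using e by (auto simp: X_def)
      then have "f M L e = (sym_part L `` {x}, sym_part L `` {y})" "E L x y"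
        using LM mono[of L M x y] by (auto simp: f_def coarsen)
      with \<open>x \<in> seps S\<close> \<open>y \<in> seps S\<close> show ?thesis unfolding X_def by blast
    qed
    show "f M L (f N M e) = f N L e"
      if "(L, M) \<in> {(L, M). L \<in> \<L> \<and> M \<in> \<L> \<and> M \<subseteq> L}"
        "(M, N) \<in> {(L, M). L \<in> \<L> \<and> M \<in> \<L> \<and> M \<subseteq> L}" "e \<in> X N" for L M N e
    proof -
      have "N \<subseteq> L" using that by blast
      then show ?thesis using that by (auto simp: X_def f_def coarsen)
    qed
  qed blast
  have zQ: "fst (z L) \<in> seps S // sym_part L" "snd (z L) \<in> seps S // sym_part L" if "L \<in> \<L>" for L
    using z XQ that by (fastforce simp: PiE_iff)+
  have sub: "C \<subseteq> sym_part L `` C" if "L \<in> \<L>" "M \<in> \<L>" "C \<in> seps S // sym_part M" for L M C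
    using in_quotient_imp_subset[OF equiv[OF that(2)] that(3)] equiv[OF that(1)]
    by (fastforce simp: equiv_def refl_on_def)
  have zmono: "fst (z M) \<subseteq> fst (z L)" "snd (z M) \<subseteq> snd (z L)"
    if "L \<in> \<L>" "M \<in> \<L>" "M \<subseteq> L" for L M
  proof -
    have "f M L (z M) = z L" using comp that by blast
    then have "fst (z L) = sym_part L `` fst (z M)" "snd (z L) = sym_part L `` snd (z M)"
      unfolding f_def by (metis fst_map_prod, metis snd_map_prod)
    then show "fst (z M) \<subseteq> fst (z L)" "snd (z M) \<subseteq> snd (z L)"
      using sub zQ that by auto
  qed
  obtain x where x: "x \<in> seps S" "\<And>L. L \<in> \<L> \<Longrightarrow> fst (z L) = sym_part L `` {x}"
    using complete_classes[of "\<lambda>L. fst (z L)"] zQ zmono by blast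
  obtain y where y: "y \<in> seps S" "\<And>L. L \<in> \<L> \<Longrightarrow> snd (z L) = sym_part L `` {y}"
    using complete_classes[of "\<lambda>L. snd (z L)"] zQ zmono by blast
  have "E L x y" if L: "L \<in> \<L>" for L
  proof -
    obtain M where M: "M \<in> \<L>" and sat: "\<And>u v u' v'. E L u v \<Longrightarrow> (u, u') \<in> sym_part M \<Longrightarrow>
        (v, v') \<in> sym_part M \<Longrightarrow> E L u' v'"
      using saturated[OF L] by blast
    \<comment> \<open>At a common refinement the thread has representatives satisfying
      \<open>E N\<close>. They agree with \<open>x\<close> and \<open>y\<close> modulo
      \<open>N\<close>, hence modulo \<open>M\<close>.\<close>
    obtain N where N: "N \<in> \<L>" "N \<subseteq> L" "N \<subseteq> M" using directed[OF L M] by blast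
    have "z N \<in> X N" using z N by auto
    then obtain u v where uv: "u \<in> seps S" "v \<in> seps S" "E N u v"
      "fst (z N) = sym_part N `` {u}" "snd (z N) = sym_part N `` {v}"
      by (auto simp: X_def)
    have "(u, x) \<in> sym_part N" "(v, y) \<in> sym_part N"
      using eq_equiv_class[OF _ equiv[OF N(1)]] uv x y N(1) by metis+
    then show ?thesis
      using sat[of u v x y] mono[OF L N(1,2) uv(3)] subsetD[OF sym_part_mono[OF N(3)]] by blast
  qed
  then show ?thesis using x(1) y(1) by blast
qed

end

section \<open>Quotients that are tree sets\<close>

text \<open>Nestedness of the quotient is inherited from \<open>S\<close>, since \<open>R\<close>
  contains \<open>sep_le S\<close>. Non-triviality has the form of \<open>tree_set_iff\<close>, with
  equality read modulo \<open>sym_part R\<close>.\<close>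

definition tree_preorder :: "'a sep_system \<Rightarrow> 'a rel \<Rightarrow> bool" where
  "tree_preorder S R \<longleftrightarrow> sep_preorder S R \<and>
     (\<forall>x\<in>seps S. (x, sep_inv S x) \<notin> sym_part R) \<and>
     (\<forall>r\<in>seps S. \<forall>s\<in>seps S. (r, s) \<in> R \<longrightarrow> (r, sep_inv S s) \<in> R \<longrightarrow>
        (s, r) \<in> R \<or> (sep_inv S s, r) \<in> R)"

section \<open>Compactness bounds on degenerate and trivial elements\<close>

context quotient_family
begin

lemma exists_nondegenerate:
  assumes nondeg: "\<And>x. x \<in> seps S \<Longrightarrow> x \<noteq> sep_inv S x"
  shows "\<exists>L\<in>\<L>. \<forall>x\<in>seps S. (x, sep_inv S x) \<notin> sym_part L"
proof (rule ccontr)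
  assume contra: "\<not> ?thesis"
  \<comment> \<open>The quantifier over \<open>y\<close> merely adapts the claim to the pairs in
    \<open>compactness\<close>.\<close>
  have "\<exists>x\<in>seps S. \<exists>y\<in>seps S. \<forall>L\<in>\<L>. (x, sep_inv S x) \<in> sym_part L"
  proof (rule compactness)
    show "\<exists>x\<in>seps S. \<exists>y\<in>seps S. (x, sep_inv S x) \<in> sym_part L" if "L \<in> \<L>" for L
      using contra that by blast
    show "(x, sep_inv S x) \<in> sym_part L" if "M \<subseteq> L" "(x, sep_inv S x) \<in> sym_part M" for L M x
      using subsetD[OF sym_part_mono] that by blast
    show "\<exists>M\<in>\<L>. \<forall>x y x' y'. (x, sep_inv S x) \<in> sym_part L \<longrightarrow> (x, x') \<in> sym_part M \<longrightarrow>
        (y, y') \<in> sym_part M \<longrightarrow> (x', sep_inv S x') \<in> sym_part L" if L: "L \<in> \<L>" for L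
    proof -
      have "(x', sep_inv S x') \<in> sym_part L"
        if "(x, sep_inv S x) \<in> sym_part L" "(x, x') \<in> sym_part L" for x x'
      proof -
        have "(x, x') \<in> L" "(x', x) \<in> L" "(x, sep_inv S x) \<in> L" "(sep_inv S x, x) \<in> L"
          "(sep_inv S x, sep_inv S x') \<in> L" "(sep_inv S x', sep_inv S x) \<in> L"
          using that sep_preorder_inv[OF preorder[OF L]] by (auto simp: sym_part_iff)
        then show ?thesis
          unfolding sym_part_iff by (meson sep_preorder_trans[OF preorder[OF L]])
      qed
      then show ?thesis using L by blast
    qed
  qed
  then obtain x where x: "x \<in> seps S" and eq: "\<And>L. L \<in> \<L> \<Longrightarrow> (x, sep_inv S x) \<in> sym_part L" by blast
  have x': "sep_inv S x \<in> seps S" using sep_inv_carrier[OF sep x] .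
  have "(x, sep_inv S x) \<in> sep_le S" "(sep_inv S x, x) \<in> sep_le S"
    using eq by (auto intro!: separating x x' simp: sym_part_iff)
  then show False using nondeg[OF x] sep_le_antisym[OF sep] by blast
qed

text \<open>An element strictly below a small \<open>m\<close> is also strictly below the inverse of
  \<open>m\<close>, hence trivial. Small elements of a tree set are therefore minimal, and this is
  the version of that fact up to precision \<open>L\<close>.\<close>

lemma exists_rigid_below_small:
  assumes tree: "tree_set S" and L: "L \<in> \<L>"
  shows "\<exists>Q\<in>\<L>. \<forall>u m. (u, m) \<in> Q \<longrightarrow> (m, sep_inv S m) \<in> Q \<longrightarrow> (m, u) \<in> L"
proof (rule ccontr)
  assume contra: "\<not> ?thesis"
  define E where "E Q u m \<longleftrightarrow> (u, m) \<in> Q \<and> (m, sep_inv S m) \<in> Q \<and> (m, u) \<notin> L" for Q :: "'a rel" and u m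
  have "\<exists>u\<in>seps S. \<exists>m\<in>seps S. \<forall>Q\<in>\<L>. E Q u m"
  proof (rule compactness)
    show "\<exists>u\<in>seps S. \<exists>m\<in>seps S. E Q u m" if Q: "Q \<in> \<L>" for Q
    proof -
      obtain u m where "E Q u m" using contra Q unfolding E_def by blast
      then show ?thesis using sep_preorder_carrier[OF preorder[OF Q], of u m] unfolding E_def by blast
    qed
    show "\<exists>M\<in>\<L>. \<forall>u m u' m'. E Q u m \<longrightarrow> (u, u') \<in> sym_part M \<longrightarrow> (m, m') \<in> sym_part M \<longrightarrow> E Q u' m'"
      if Q: "Q \<in> \<L>" for Q
    proof -
      \<comment> \<open>\<open>E Q\<close> refers to \<open>L\<close> as well, so the level is taken
        below both.\<close>
      obtain M where M: "M \<in> \<L>" "M \<subseteq> Q" "M \<subseteq> L" using directed[OF Q L] by blast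
      have "E Q u' m'" if e: "E Q u m" and u: "(u, u') \<in> sym_part M" and m: "(m, m') \<in> sym_part M"
        for u m u' m'
      proof -
        note tQ = sep_preorder_trans[OF preorder[OF Q]] and tL = sep_preorder_trans[OF preorder[OF L]]
        have Q1: "(u', u) \<in> Q" "(m, m') \<in> Q" "(m', m) \<in> Q"
          and L1: "(u', u) \<in> L" "(m, m') \<in> L" using u m M by (auto simp: sym_part_iff)
        have "(sep_inv S m, sep_inv S m') \<in> Q" using sep_preorder_inv[OF preorder[OF Q] Q1(3)] .
        then show ?thesis
          using e Q1 L1 unfolding E_def by (meson tQ tL)
      qed
      then show ?thesis using M(1) by blast
    qed
  qed (auto simp: E_def)
  then obtain u m where um: "u \<in> seps S" "m \<in> seps S" "\<And>Q. Q \<in> \<L> \<Longrightarrow> E Q u m" by blast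
  have m': "sep_inv S m \<in> seps S" using sep_inv_carrier[OF sep um(2)] .
  have le: "(u, m) \<in> sep_le S" "(m, sep_inv S m) \<in> sep_le S"
    using separating um m' unfolding E_def by blast+
  then have "(u, sep_inv S m) \<in> sep_le S" using sep_le_trans[OF sep] by blast
  then have "u = m \<or> u = sep_inv S m" using tree le um unfolding tree_set_iff by blast
  moreover have "u \<noteq> m"
    using um(3)[OF L] sep_preorder_refl[OF sep preorder[OF L] um(2)] unfolding E_def by blast
  \<comment> \<open>Otherwise \<open>m\<close> and its inverse lie below each other, and
    \<open>m\<close> is degenerate.\<close>
  moreover have "u \<noteq> sep_inv S m"
    using le sep_le_antisym[OF sep] tree um(2) unfolding tree_set_iff by metis
  ultimately show False by blast
qed

text \<open>A limit of trivialities satisfies \<open>r \<le> s\<close> and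
  \<open>r \<le> sep_inv S s\<close>, so in a tree set \<open>r\<close> equals one of the two.
  Either way \<open>s\<close> is comparable to its own inverse, contrary to the choice of
  witnesses.\<close>

lemma exists_small_witnesses:
  assumes tree: "tree_set S" and Q: "Q \<in> \<L>"
  shows "\<exists>W\<in>\<L>. \<forall>r s. (r, s) \<in> W \<longrightarrow> (r, sep_inv S s) \<in> W \<longrightarrow>
    (s, sep_inv S s) \<in> Q \<or> (sep_inv S s, s) \<in> Q"
proof (rule ccontr)
  assume contra: "\<not> ?thesis"
  define E where "E W r s \<longleftrightarrow> (r, s) \<in> W \<and> (r, sep_inv S s) \<in> W \<and>
    (s, sep_inv S s) \<notin> Q \<and> (sep_inv S s, s) \<notin> Q" for W :: "'a rel" and r s
  have "\<exists>r\<in>seps S. \<exists>s\<in>seps S. \<forall>W\<in>\<L>. E W r s"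
  proof (rule compactness)
    show "\<exists>r\<in>seps S. \<exists>s\<in>seps S. E W r s" if W: "W \<in> \<L>" for W
    proof -
      obtain r s where "E W r s" using contra W unfolding E_def by blast
      then show ?thesis using sep_preorder_carrier[OF preorder[OF W], of r s] unfolding E_def by blast
    qed
    show "\<exists>M\<in>\<L>. \<forall>r s r' s'. E W r s \<longrightarrow> (r, r') \<in> sym_part M \<longrightarrow> (s, s') \<in> sym_part M \<longrightarrow> E W r' s'"
      if W: "W \<in> \<L>" for W
    proof -
      obtain M where M: "M \<in> \<L>" "M \<subseteq> W" "M \<subseteq> Q" using directed[OF W Q] by blast
      have "E W r' s'" if e: "E W r s" and r: "(r, r') \<in> sym_part M" and s: "(s, s') \<in> sym_part M"
        for r s r' s'
      proof -
        note tW = sep_preorder_trans[OF preorder[OF W]] and tQ = sep_preorder_trans[OF preorder[OF Q]]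
        note iM = sep_preorder_inv[OF preorder[OF M(1)]]
        have W1: "(r', r) \<in> W" "(s, s') \<in> W" "(sep_inv S s, sep_inv S s') \<in> W"
          using r s M(2) iM by (auto simp: sym_part_iff)
        have Q1: "(s, s') \<in> Q" "(s', s) \<in> Q"
          "(sep_inv S s, sep_inv S s') \<in> Q" "(sep_inv S s', sep_inv S s) \<in> Q"
          using s M(3) iM by (auto simp: sym_part_iff)
        have "(r', s') \<in> W" "(r', sep_inv S s') \<in> W"
          using e W1 unfolding E_def by (meson tW)+
        moreover have "(s', sep_inv S s') \<notin> Q" "(sep_inv S s', s') \<notin> Q"
          using e Q1 unfolding E_def by (meson tQ)+
        ultimately show ?thesis unfolding E_def by blast
      qed
      then show ?thesis using M(1) by blast
    qed
  qed (auto simp: E_def)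
  then obtain r s where rs: "r \<in> seps S" "s \<in> seps S" "\<And>W. W \<in> \<L> \<Longrightarrow> E W r s" by blast
  have s': "sep_inv S s \<in> seps S" using sep_inv_carrier[OF sep rs(2)] .
  have le: "(r, s) \<in> sep_le S" "(r, sep_inv S s) \<in> sep_le S"
    using separating rs s' unfolding E_def by blast+
  then have "r = s \<or> r = sep_inv S s" using tree rs unfolding tree_set_iff by blast
  then have "(s, sep_inv S s) \<in> Q \<or> (sep_inv S s, s) \<in> Q"
    using le sep_preorder_le[OF preorder[OF Q]] by blast
  then show False using rs(3)[OF Q] unfolding E_def by blast
qed

text \<open>Choose a level \<open>Q\<close> finer than \<open>L\<close> at which everything below a small element lies in its
  \<open>L\<close>-class, and a level \<open>W\<close> finer than \<open>Q\<close> at which every witness of a triviality is small or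
  co-small in \<open>Q\<close>. Collapsing the set \<open>U\<close> of elements small in \<open>Q\<close> to pairwise incomparable leaves,
  while retaining their \<open>L\<close>-class and their position in \<open>W\<close> relative to the set \<open>V\<close> of elements that
  are neither small nor co-small, yields a tree set lying between the levels \<open>L\<close> and \<open>W\<close>.\<close>

lemma exists_tree_preorder:
  assumes tree: "tree_set S" and K: "K \<in> \<L>"
  shows "\<exists>R W. tree_preorder S R \<and> R \<subseteq> K \<and> W \<in> \<L> \<and> W \<subseteq> R"
proof -
  let ?i = "sep_inv S"
  have nested: "(r, s) \<in> sep_le S \<or> (r, ?i s) \<in> sep_le S \<or> (?i r, s) \<in> sep_le S \<or> (?i r, ?i s) \<in> sep_le S"
    if "r \<in> seps S" "s \<in> seps S" for r s using tree that by (auto simp: tree_set_iff)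
  have ii [simp]: "?i (?i x) = x" if "x \<in> seps S" for x using sep_inv_inv[OF sep that] .
  have ic [simp]: "?i x \<in> seps S" if "x \<in> seps S" for x using sep_inv_carrier[OF sep that] .
  have nd: "x \<noteq> ?i x" if "x \<in> seps S" for x using tree that unfolding tree_set_iff by blast
  obtain L0 where L0: "L0 \<in> \<L>" "\<And>x. x \<in> seps S \<Longrightarrow> (x, ?i x) \<notin> sym_part L0"
    using exists_nondegenerate[OF nd] by blast
  obtain L where L: "L \<in> \<L>" "L \<subseteq> K" "L \<subseteq> L0" using directed[OF K L0(1)] by blast
  have nondeg: "(x, ?i x) \<notin> sym_part L" if "x \<in> seps S" for x
    using L0(2)[OF that] sym_part_mono[OF L(3)] by blast
  obtain Q0 where Q0: "Q0 \<in> \<L>" and rigid0: "\<And>u m. (u, m) \<in> Q0 \<Longrightarrow> (m, ?i m) \<in> Q0 \<Longrightarrow> (m, u) \<in> L"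
    using exists_rigid_below_small[OF tree L(1)] by blast
  obtain Q where Q: "Q \<in> \<L>" "Q \<subseteq> Q0" "Q \<subseteq> L" using directed[OF Q0 L(1)] by blast
  have rigid: "(m, u) \<in> L" if "(u, m) \<in> Q" "(m, ?i m) \<in> Q" for u m
    using rigid0 that Q(2) by blast
  obtain W0 where W0: "W0 \<in> \<L>" and wit0: "\<And>r s. (r, s) \<in> W0 \<Longrightarrow> (r, ?i s) \<in> W0 \<Longrightarrow>
      (s, ?i s) \<in> Q \<or> (?i s, s) \<in> Q"
    using exists_small_witnesses[OF tree Q(1)] by blast
  obtain W where W: "W \<in> \<L>" "W \<subseteq> W0" "W \<subseteq> Q" using directed[OF W0 Q(1)] by blast
  note tQ = sep_preorder_trans[OF preorder[OF Q(1)]] and iQ = sep_preorder_inv[OF preorder[OF Q(1)]]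
    and tW = sep_preorder_trans[OF preorder[OF W(1)]] and iW = sep_preorder_inv[OF preorder[OF W(1)]]
    and cW = sep_preorder_carrier[OF preorder[OF W(1)]] and leW = sep_preorder_le[OF preorder[OF W(1)]]
    and tL = sep_preorder_trans[OF preorder[OF L(1)]] and iL = sep_preorder_inv[OF preorder[OF L(1)]]
    and leL = sep_preorder_le[OF preorder[OF L(1)]]
  define U where "U = {u \<in> seps S. (u, ?i u) \<in> Q}"
  define V where "V = {v \<in> seps S. v \<notin> U \<and> ?i v \<notin> U}"
  \<comment> \<open>An element both small and co-small in \<open>Q\<close> would be degenerate in
    \<open>L\<close>.\<close>
  have Ui: "?i u \<notin> U" if "u \<in> U" for u
    using that nondeg Q(3) by (auto simp: U_def sym_part_iff)
  have Vi: "?i v \<in> V" if "v \<in> V" for v using that by (auto simp: V_def)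
  have down: "u \<in> U" if "(u, u') \<in> Q" "u' \<in> U" for u u'
    using that iQ[OF that(1)] tQ sep_preorder_carrier[OF preorder[OF Q(1)] that(1)]
    unfolding U_def by blast
  have downW: "u \<in> U" if "(u, u') \<in> W" "u' \<in> U" for u u'
    using down that W(3) by blast
  have wit: False if "(r, s) \<in> W" "(r, ?i s) \<in> W" "s \<in> V" for r s
    using wit0[OF subsetD[OF W(2) that(1)] subsetD[OF W(2) that(2)]] that(3) by (auto simp: U_def V_def)
  \<comment> \<open>Agreement in \<open>L\<close> keeps the collapsed relation inside
    \<open>L\<close>. Agreement over \<open>V\<close> makes comparisons with \<open>V\<close>
    independent of the representative of a leaf.\<close>
  define same where "same x y \<longleftrightarrow> x \<in> U \<and> y \<in> U \<and> (x, y) \<in> L \<and> (y, x) \<in> L \<and>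
    (\<forall>s\<in>V. (x, s) \<in> W \<longleftrightarrow> (y, s) \<in> W)" for x y
  have same_sym: "same y x" if "same x y" for x y using that by (auto simp: same_def)
  have same_trans: "same x z" if "same x y" "same y z" for x y z
    using that tL unfolding same_def by blast
  \<comment> \<open>The conditions \<open>y \<notin> U\<close> and \<open>?i x \<notin> U\<close>
    keep everything else from lying below a leaf or above an inverse of a leaf. The last disjunct
    puts every leaf below every inverse of a leaf: \<open>same\<close> does not record such
    comparisons, so \<open>W\<close> alone need not respect its classes.\<close>
  define fwd where "fwd x y \<longleftrightarrow> x \<in> seps S \<and> y \<in> seps S \<and> y \<notin> U \<and> ?i x \<notin> U \<and>
    ((x, y) \<in> W \<or> x \<in> U \<and> ?i y \<in> U)" for x y
  define R where "R = {(x, y). x \<in> seps S \<and> y \<in> seps S \<and> (fwd x y \<or> same x y \<or> same (?i x) (?i y))}"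
  have R: "(x, y) \<in> R \<longleftrightarrow> x \<in> seps S \<and> y \<in> seps S \<and> (fwd x y \<or> same x y \<or> same (?i x) (?i y))" for x y
    by (simp add: R_def)
  \<comment> \<open>For \<open>W \<subseteq> R\<close>, a step down inside \<open>U\<close> must
    stay within one leaf: \<open>rigid\<close> takes care of the \<open>L\<close>-class, nestedness
    and \<open>wit\<close> of the position relative to \<open>V\<close>.\<close>
  have sameU: "same x y" if xy: "(x, y) \<in> W" and y: "y \<in> U" for x y
  proof -
    have x: "x \<in> U" using downW xy y .
    have yS: "y \<in> seps S" using y by (simp add: U_def)
    have "(y, x) \<in> L" using rigid[of x y] xy y W(3) by (auto simp: U_def)
    moreover have "(y, s) \<in> W" if s: "s \<in> V" and xs: "(x, s) \<in> W" for s
    proof (rule ccontr)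
      assume ys: "(y, s) \<notin> W"
      have sS: "s \<in> seps S" using s by (simp add: V_def)
      consider "(y, s) \<in> W" | "(y, ?i s) \<in> W" | "(?i s, y) \<in> W" | "(s, y) \<in> W"
        using nested[OF yS sS] leW iW[of "?i y" s] iW[of "?i y" "?i s"] yS sS by auto
      then show False
      proof cases
        \<comment> \<open>Now \<open>x\<close> lies below \<open>s\<close> and below its inverse in
          \<open>W\<close>, but no member of \<open>V\<close> witnesses a triviality there.\<close>
        case 2
        then show ?thesis using wit[OF xs _ s] tW[OF xy] by blast
      qed (use ys s downW[OF _ y] in \<open>auto simp: V_def\<close>)
    qed
    moreover have "(x, s) \<in> W" if "(y, s) \<in> W" for s using tW[OF xy that] .
    ultimately show ?thesis using x y xy W(3) Q(3) unfolding same_def by blast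
  qed
  have WR: "W \<subseteq> R"
  proof (rule subrelI)
    fix x y assume xy: "(x, y) \<in> W"
    then have S: "x \<in> seps S" "y \<in> seps S" using cW by blast+
    consider "y \<in> U" | "?i x \<in> U" | "y \<notin> U" "?i x \<notin> U" by blast
    then show "(x, y) \<in> R"
    proof cases
      case 1 then show ?thesis using sameU[OF xy] S R by blast
    next
      case 2 then show ?thesis using sameU[OF iW[OF xy]] same_sym S R by blast
    next
      case 3 then show ?thesis using xy S R fwd_def by blast
    qed
  qed
  have fwd_inv: "fwd (?i y) (?i x)" if "fwd x y" for x y
    using that iW[of x y] unfolding fwd_def by auto
  have fwd_same: "fwd x z" if xy: "fwd x y" and yz: "same (?i y) (?i z)" and zS: "z \<in> seps S" for x y z
  proof (cases "x \<in> U")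
    case True
    then show ?thesis using xy yz zS Ui[of "?i z"] unfolding fwd_def same_def by auto
  next
    case False
    \<comment> \<open>The comparison is one with a member of \<open>V\<close>, which
      \<open>same\<close> transports after inversion.\<close>
    then have x: "?i x \<in> V" and w: "(?i y, ?i x) \<in> W" using xy iW unfolding fwd_def V_def by auto
    then have "(?i z, ?i x) \<in> W" using yz unfolding same_def by blast
    then have "(x, z) \<in> W" using iW[of "?i z" "?i x"] zS xy by (simp add: fwd_def)
    then show ?thesis using xy yz zS Ui[of "?i z"] unfolding fwd_def same_def by auto
  qed
  have transR: "(x, z) \<in> R" if xy: "(x, y) \<in> R" and yz: "(y, z) \<in> R" for x y z
  proof -
    have S: "x \<in> seps S" "y \<in> seps S" "z \<in> seps S" using that R by auto
    consider (ff) "fwd x y" "fwd y z" | (fU) "fwd x y" "same y z" | (fU') "fwd x y" "same (?i y) (?i z)"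
      | (Uf) "same x y" "fwd y z" | (UU) "same x y" "same y z" | (UU') "same x y" "same (?i y) (?i z)"
      | (U'f) "same (?i x) (?i y)" "fwd y z" | (U'U) "same (?i x) (?i y)" "same y z"
      | (U'U') "same (?i x) (?i y)" "same (?i y) (?i z)"
      using xy yz R by blast
    then show ?thesis
    proof cases
      case ff
      \<comment> \<open>The middle element is neither small nor co-small, so both relations come
        from \<open>W\<close>.\<close>
      then have "fwd x z" using tW unfolding fwd_def by blast
      then show ?thesis using R S by blast
    next
      case fU'
      then show ?thesis using fwd_same R S by blast
    next
      case Uf
      have "fwd (?i z) (?i x)"
        using fwd_same[OF fwd_inv[OF Uf(2)], of "?i x"] same_sym[OF Uf(1)] S by simp
      then have "fwd x z" using fwd_inv[of "?i z" "?i x"] S by simp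
      then show ?thesis using R S by blast
    next
      case UU
      then show ?thesis using same_trans R S by blast
    next
      case U'U'
      then show ?thesis using same_trans R S by blast
    \<comment> \<open>In the four remaining cases the requirements on \<open>y\<close> contradict
      each other.\<close>
    qed (use Ui in \<open>auto simp: fwd_def same_def\<close>)
  qed
  have invR: "(?i y, ?i x) \<in> R" if "(x, y) \<in> R" for x y
    using that fwd_inv[of x y] same_sym[of x y] same_sym[of "?i x" "?i y"] unfolding R by auto
  have RL: "R \<subseteq> L"
  proof (rule subrelI)
    fix x y assume "(x, y) \<in> R"
    then have S: "x \<in> seps S" "y \<in> seps S" and "fwd x y \<or> same x y \<or> same (?i x) (?i y)"
      using R by auto
    then consider "(x, y) \<in> W" | (leaves) "x \<in> U" "?i y \<in> U" | "same x y" | "same (?i x) (?i y)"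
      unfolding fwd_def by blast
    then show "(x, y) \<in> L"
    proof cases
      case leaves
      have xx: "(x, ?i x) \<in> Q" and yy: "(?i y, y) \<in> Q" using leaves S by (auto simp: U_def)
      \<comment> \<open>The relations added between leaves and inverses of leaves already hold in
        \<open>L\<close>: three of the nested positions imply them by smallness of \<open>x\<close>
        or \<open>?i y\<close>, and the fourth would make \<open>x\<close> co-small.\<close>
      consider "(x, y) \<in> sep_le S" | "(x, ?i y) \<in> sep_le S" | "(?i x, y) \<in> sep_le S" | "(?i x, ?i y) \<in> sep_le S"
        using nested[OF S] by blast
      then show ?thesis
      proof cases
        case 1 then show ?thesis using leL by blast
      next
        case 2 then show ?thesis using leL yy Q(3) tL by blast
      next
        case 3 then show ?thesis using leL xx Q(3) tL by blast
      next
        case 4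
        then have "(?i x, ?i y) \<in> Q" using leW W(3) by blast
        then have "?i x \<in> U" using down leaves(2) by blast
        then show ?thesis using Ui[OF leaves(1)] by blast
      qed
    next
      case 4
      then show ?thesis using iL[of "?i y" "?i x"] S by (simp add: same_def)
    qed (use W(3) Q(3) in \<open>auto simp: same_def\<close>)
  qed
  have "sep_preorder S R"
    unfolding sep_preorder_def
  proof (intro conjI)
    show "sep_le S \<subseteq> R" using leW WR by auto
  qed (use transR invR in \<open>auto simp: R_def intro: transI\<close>)
  moreover have "(x, ?i x) \<notin> sym_part R" if "x \<in> seps S" for x
    using nondeg[OF that] sym_part_mono[OF RL] by blast
  moreover have "(s, r) \<in> R \<or> (?i s, r) \<in> R"
    if rs: "(r, s) \<in> R" and rs': "(r, ?i s) \<in> R" for r s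
  proof -
    have S: "r \<in> seps S" "s \<in> seps S" using rs R by auto
    have conv: "(y, x) \<in> R" if "\<not> fwd x y" "(x, y) \<in> R" for x y
      using that same_sym unfolding R by blast
    \<comment> \<open>Two such relations would force \<open>s \<in> V\<close>, which rules out the
      leaf disjunct and leaves a triviality in \<open>W\<close> witnessed by \<open>s\<close>. All
      other relations in \<open>R\<close> are symmetric.\<close>
    have "\<not> (fwd r s \<and> fwd r (?i s))"
      using wit[of r s] S by (auto simp: fwd_def V_def)
    then show ?thesis using conv rs rs' by blast
  qed
  ultimately have "tree_preorder S R" by (auto simp: tree_preorder_def)
  then show ?thesis using RL L(2) W(1) WR by blast
qed

end

text \<open>Every given level contains a tree preorder of the new family, and every member of the
  new family contains a given level. This mutual cofinality transfers separation and
  completeness.\<close>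

lemma (in quotient_family) tree_quotient_family:
  assumes tree: "tree_set S"
  shows "quotient_family S {R. tree_preorder S R \<and> (\<exists>L\<in>\<L>. L \<subseteq> R)}"
proof -
  define \<R> where "\<R> = {R. tree_preorder S R \<and> (\<exists>L\<in>\<L>. L \<subseteq> R)}"
  have pre: "sep_preorder S R" if "R \<in> \<R>" for R using that by (auto simp: \<R>_def tree_preorder_def)
  have below: "\<exists>L\<in>\<L>. L \<subseteq> R" if "R \<in> \<R>" for R using that by (auto simp: \<R>_def)
  have refine: "\<exists>R\<in>\<R>. R \<subseteq> L" if "L \<in> \<L>" for L
    using exists_tree_preorder[OF tree that] unfolding \<R>_def by blast
  have dir: "\<exists>T\<in>\<R>. T \<subseteq> R \<and> T \<subseteq> R'" if R: "R \<in> \<R>" "R' \<in> \<R>" for R R'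
  proof -
    obtain L where L: "L \<in> \<L>" "L \<subseteq> R" using below[OF R(1)] by blast
    obtain L' where L': "L' \<in> \<L>" "L' \<subseteq> R'" using below[OF R(2)] by blast
    obtain M where M: "M \<in> \<L>" "M \<subseteq> L" "M \<subseteq> L'" using directed[OF L(1) L'(1)] by blast
    obtain T where "T \<in> \<R>" "T \<subseteq> M" using refine[OF M(1)] by blast
    then show ?thesis using L(2) L'(2) M(2,3) by (meson subset_trans)
  qed
  have "quotient_family S \<R>"
  proof
    show "\<R> \<noteq> {}" using family_nonempty refine by blast
    show "finite (seps S // sym_part R)" if R: "R \<in> \<R>" for R
    proof -
      obtain L where L: "L \<in> \<L>" "L \<subseteq> R" using below[OF R] by blast
      show ?thesis
        using finite_quotient_coarser[OF equiv[OF L(1)] sep_preorder_sym_part_equiv[OF sep pre[OF R]]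
            sym_part_mono[OF L(2)] fin[OF L(1)]] .
    qed
    show "(x, y) \<in> sep_le S" if "x \<in> seps S" "y \<in> seps S" "\<And>R. R \<in> \<R> \<Longrightarrow> (x, y) \<in> R" for x y
      using separating[OF that(1,2)] refine that(3) by blast
    show "\<exists>x\<in>seps S. \<forall>R\<in>\<R>. (x, c R) \<in> sym_part R"
      if c: "\<And>R. R \<in> \<R> \<Longrightarrow> c R \<in> seps S"
        and coh: "\<And>R T. R \<in> \<R> \<Longrightarrow> T \<in> \<R> \<Longrightarrow> T \<subseteq> R \<Longrightarrow> (c T, c R) \<in> sym_part R" for c
    proof -
      \<comment> \<open>The choice need not be monotone, so its values at two levels are compared
        through a common refinement \<open>T\<close>.\<close>
      obtain \<rho> where \<rho>: "\<And>L. L \<in> \<L> \<Longrightarrow> \<rho> L \<in> \<R>" "\<And>L. L \<in> \<L> \<Longrightarrow> \<rho> L \<subseteq> L"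
        using refine by metis
      have "\<exists>x\<in>seps S. \<forall>L\<in>\<L>. (x, c (\<rho> L)) \<in> sym_part L"
      proof (rule complete)
        show "c (\<rho> L) \<in> seps S" if "L \<in> \<L>" for L using c \<rho>(1) that by blast
        show "(c (\<rho> M), c (\<rho> L)) \<in> sym_part L" if L: "L \<in> \<L>" "M \<in> \<L>" "M \<subseteq> L" for L M
        proof -
          obtain T where T: "T \<in> \<R>" "T \<subseteq> \<rho> L" "T \<subseteq> \<rho> M" using dir[OF \<rho>(1)[OF L(1)] \<rho>(1)[OF L(2)]] by blast
          have "(c T, c (\<rho> L)) \<in> sym_part (\<rho> L)" "(c T, c (\<rho> M)) \<in> sym_part (\<rho> M)"
            using coh[OF \<rho>(1)[OF L(1)] T(1,2)] coh[OF \<rho>(1)[OF L(2)] T(1,3)] by blast+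
          then have "(c T, c (\<rho> L)) \<in> sym_part L" "(c T, c (\<rho> M)) \<in> sym_part L"
            using sym_part_mono[OF \<rho>(2)[OF L(1)]] sym_part_mono[OF subset_trans[OF \<rho>(2)[OF L(2)] L(3)]]
            by blast+
          then show ?thesis using equiv[OF L(1)] by (meson equivE symD transD)
        qed
      qed
      then obtain x where x: "x \<in> seps S" "\<And>L. L \<in> \<L> \<Longrightarrow> (x, c (\<rho> L)) \<in> sym_part L" by blast
      have "(x, c R) \<in> sym_part R" if R: "R \<in> \<R>" for R
      proof -
        obtain L where L: "L \<in> \<L>" "L \<subseteq> R" using below[OF R] by blast
        have "(x, c (\<rho> L)) \<in> sym_part R" using x(2)[OF L(1)] sym_part_mono[OF L(2)] by blast
        moreover have "(c (\<rho> L), c R) \<in> sym_part R" using coh[OF R \<rho>(1)[OF L(1)]] \<rho>(2)[OF L(1)] L(2) by blast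
        ultimately show ?thesis
          using sep_preorder_sym_part_equiv[OF sep pre[OF R]] by (meson equivE transD)
      qed
      then show ?thesis using x(1) by blast
    qed
  qed (use sep pre dir in blast)+
  then show ?thesis unfolding \<R>_def .
qed

section \<open>From inverse limits to quotient families\<close>

lemma profinite_imp_quotient_family:
  assumes "profinite TYPE('j) TYPE('c) (S :: 'a sep_system)"
  shows "\<exists>\<L>. quotient_family S \<L>"
proof -
  obtain P :: "'j set" and leP and D :: "'j \<Rightarrow> 'c sep_system" and f \<phi>
    where sep: "separation_system S" and sys: "inverse_system P leP D f"
      and fin: "\<And>p. p \<in> P \<Longrightarrow> finite (seps (D p))"
      and iso: "sep_iso S (inverse_limit P leP D f) \<phi>"
    using assms unfolding profinite_def isomorphic_def by blast
  let ?C = "compatible_families P leP D f"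
  have P: "directed_poset P leP" and D: "\<And>p. p \<in> P \<Longrightarrow> separation_system (D p)"
    and f: "\<And>p q. (p, q) \<in> leP \<Longrightarrow> sep_hom (D q) (D p) (f q p)"
    using sys by (auto simp: inverse_system_def)
  have bij: "bij_betw \<phi> (seps S) ?C" using iso by (simp add: sep_iso_def)
  have \<phi>C: "\<phi> x \<in> ?C" if "x \<in> seps S" for x using bij that by (auto simp: bij_betw_def)
  have mem: "\<phi> x p \<in> seps (D p)" if "x \<in> seps S" "p \<in> P" for x p
    using \<phi>C[OF that(1)] that(2) by (auto simp: compatible_families_def)
  have step: "f q p (\<phi> x q) = \<phi> x p" if "x \<in> seps S" "(p, q) \<in> leP" for x p q
    using \<phi>C[OF that(1)] that(2) by (auto simp: compatible_families_def)
  have \<phi>inv: "\<phi> (sep_inv S x) p = sep_inv (D p) (\<phi> x p)" if "x \<in> seps S" "p \<in> P" for x p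
    using iso that by (simp add: sep_iso_def sep_hom_def)
  have \<phi>le: "(\<phi> x p, \<phi> y p) \<in> sep_le (D p)" if "(x, y) \<in> sep_le S" "p \<in> P" for x y p
    using iso that sep_le_carrier[OF sep that(1)] by (simp add: sep_iso_def sep_hom_def)
  have \<phi>le': "(x, y) \<in> sep_le S"
    if "x \<in> seps S" "y \<in> seps S" "\<And>p. p \<in> P \<Longrightarrow> (\<phi> x p, \<phi> y p) \<in> sep_le (D p)" for x y
  proof -
    have "(inv_into (seps S) \<phi> (\<phi> x), inv_into (seps S) \<phi> (\<phi> y)) \<in> sep_le S"
      using iso that \<phi>C unfolding sep_iso_def sep_hom_def by simp
    then show ?thesis using bij that by (simp add: bij_betw_def)
  qed
  \<comment> \<open>This pulls the order of \<open>D p\<close> back along the \<open>p\<close>-th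
    coordinate. That coordinate need not be surjective, so the encoded quotient is its image in
    \<open>D p\<close>.\<close>
  define \<Lambda> where "\<Lambda> p = {(x, y). x \<in> seps S \<and> y \<in> seps S \<and> (\<phi> x p, \<phi> y p) \<in> sep_le (D p)}" for p
  have sym: "(x, y) \<in> sym_part (\<Lambda> p) \<longleftrightarrow> x \<in> seps S \<and> y \<in> seps S \<and> \<phi> x p = \<phi> y p" if "p \<in> P" for x y p
    using sep_le_antisym[OF D[OF that]] sep_le_refl[OF D[OF that] mem[OF _ that]]
    by (auto simp: \<Lambda>_def sym_part_iff)
  have anti: "\<Lambda> q \<subseteq> \<Lambda> p" if pq: "(p, q) \<in> leP" for p q
  proof (rule subrelI)
    fix x y assume "(x, y) \<in> \<Lambda> q"
    then have xy: "x \<in> seps S" "y \<in> seps S" "(\<phi> x q, \<phi> y q) \<in> sep_le (D q)" by (auto simp: \<Lambda>_def)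
    have "q \<in> P" using directed_poset_carrier[OF P pq] by blast
    then have "(f q p (\<phi> x q), f q p (\<phi> y q)) \<in> sep_le (D p)"
      using f[OF pq] xy mem unfolding sep_hom_def by blast
    then show "(x, y) \<in> \<Lambda> p" using xy pq by (simp add: step \<Lambda>_def)
  qed
  have "quotient_family S (\<Lambda> ` P)"
  proof
    show "\<Lambda> ` P \<noteq> {}" using P by (auto simp: directed_poset_def)
    show "sep_preorder S L" if L: "L \<in> \<Lambda> ` P" for L
    proof -
      obtain p where p: "p \<in> P" "L = \<Lambda> p" using L by blast
      have "trans L"
        using sep_le_trans[OF D[OF p(1)]] unfolding p(2) \<Lambda>_def trans_def by blast
      moreover have "(sep_inv S y, sep_inv S x) \<in> L" if "(x, y) \<in> L" for x y
        using that sep_le_inv[OF D[OF p(1)]] p sep_inv_carrier[OF sep] by (auto simp: \<Lambda>_def \<phi>inv)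
      moreover have "sep_le S \<subseteq> L"
        using \<phi>le p sep_le_carrier[OF sep] by (auto simp: \<Lambda>_def)
      ultimately show ?thesis using p(2) unfolding sep_preorder_def by (auto simp: \<Lambda>_def)
    qed
    show "finite (seps S // sym_part L)" if L: "L \<in> \<Lambda> ` P" for L
    proof -
      obtain p where p: "p \<in> P" "L = \<Lambda> p" using L by blast
      have "sym_part L `` {x} = {y \<in> seps S. \<phi> x p = \<phi> y p}" if "x \<in> seps S" for x
        using that sym[OF p(1)] unfolding p(2) by blast
      then have "seps S // sym_part L \<subseteq> (\<lambda>a. {y \<in> seps S. a = \<phi> y p}) ` seps (D p)"
        using mem p(1) unfolding quotient_def by blast
      then show ?thesis using finite_surj[OF fin[OF p(1)]] by blast
    qed
    show "\<exists>M\<in>\<Lambda> ` P. M \<subseteq> L \<and> M \<subseteq> L'" if "L \<in> \<Lambda> ` P" "L' \<in> \<Lambda> ` P" for L L'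
    proof -
      obtain p q where pq: "p \<in> P" "q \<in> P" "L = \<Lambda> p" "L' = \<Lambda> q" using \<open>L \<in> \<Lambda> ` P\<close> \<open>L' \<in> \<Lambda> ` P\<close> by blast
      obtain t where t: "(p, t) \<in> leP" "(q, t) \<in> leP" using directed_poset_ub[OF P pq(1,2)] by blast
      then show ?thesis using anti pq directed_poset_carrier[OF P t(1)] by blast
    qed
    show "(x, y) \<in> sep_le S"
      if "x \<in> seps S" "y \<in> seps S" "\<And>L. L \<in> \<Lambda> ` P \<Longrightarrow> (x, y) \<in> L" for x y
      using \<phi>le'[OF that(1,2)] that(3) by (auto simp: \<Lambda>_def)
    show "\<exists>x\<in>seps S. \<forall>L\<in>\<Lambda> ` P. (x, c L) \<in> sym_part L"
      if c: "\<And>L. L \<in> \<Lambda> ` P \<Longrightarrow> c L \<in> seps S"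
        and coh: "\<And>L M. L \<in> \<Lambda> ` P \<Longrightarrow> M \<in> \<Lambda> ` P \<Longrightarrow> M \<subseteq> L \<Longrightarrow> (c M, c L) \<in> sym_part L" for c
    proof -
      \<comment> \<open>Reading coordinate \<open>p\<close> off the representative chosen for level
        \<open>p\<close> gives a compatible family, hence an element of \<open>S\<close>.\<close>
      define t where "t = (\<lambda>p\<in>P. \<phi> (c (\<Lambda> p)) p)"
      have "f q p (t q) = t p" if pq: "(p, q) \<in> leP" for p q
      proof -
        have PP: "p \<in> P" "q \<in> P" using directed_poset_carrier[OF P pq] by auto
        have "f q p (t q) = \<phi> (c (\<Lambda> q)) p" using step[OF c pq] PP by (simp add: t_def)
        also have "\<dots> = \<phi> (c (\<Lambda> p)) p" using coh[OF _ _ anti[OF pq]] PP sym[OF PP(1)] by blast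
        finally show ?thesis using PP by (simp add: t_def)
      qed
      then have "t \<in> ?C" using c mem by (auto simp: compatible_families_def t_def)
      then obtain x where x: "x \<in> seps S" "\<phi> x = t"
        using bij_betw_imp_surj_on[OF bij] by (metis imageE)
      then have "(x, c (\<Lambda> p)) \<in> sym_part (\<Lambda> p)" if "p \<in> P" for p
        using sym[OF that] c that by (simp add: t_def)
      then show ?thesis using x(1) by blast
    qed
  qed (rule sep)
  then show ?thesis by blast
qed

section \<open>Quotient systems and their inverse limit\<close>

definition quotient_system :: "'a sep_system \<Rightarrow> 'a rel \<Rightarrow> 'a set sep_system" where
  "quotient_system S R =
     \<lparr> seps = seps S // sym_part R,
       sep_le = {(sym_part R `` {x}, sym_part R `` {y}) | x y. (x, y) \<in> R},
       sep_inv = image (sep_inv S) \<rparr>"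

lemma quotient_system_seps [simp]: "seps (quotient_system S R) = seps S // sym_part R"
  by (simp add: quotient_system_def)

lemma quotient_system_le_iff:
  assumes "separation_system S" "sep_preorder S R" "x \<in> seps S" "y \<in> seps S"
  shows "(sym_part R `` {x}, sym_part R `` {y}) \<in> sep_le (quotient_system S R) \<longleftrightarrow> (x, y) \<in> R"
proof
  note trans = sep_preorder_trans[OF assms(2)]
  assume "(sym_part R `` {x}, sym_part R `` {y}) \<in> sep_le (quotient_system S R)"
  then obtain x' y' where eq: "sym_part R `` {x} = sym_part R `` {x'}"
      "sym_part R `` {y} = sym_part R `` {y'}" and le: "(x', y') \<in> R"
    by (auto simp: quotient_system_def)
  have "(x, x') \<in> sym_part R" "(y, y') \<in> sym_part R"
    using eq eq_equiv_class[OF _ sep_preorder_sym_part_equiv[OF assms(1,2)]]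
      sep_preorder_carrier[OF assms(2) le] by metis+
  then show "(x, y) \<in> R" using le trans unfolding sym_part_iff by blast
qed (auto simp: quotient_system_def)

lemma quotient_system_inv:
  assumes "separation_system S" "sep_preorder S R" "x \<in> seps S"
  shows "sep_inv (quotient_system S R) (sym_part R `` {x}) = sym_part R `` {sep_inv S x}"
proof -
  note inv = sep_preorder_inv[OF assms(2)] and ii = sep_inv_inv[OF assms(1)]
    and carrier = sep_preorder_carrier[OF assms(2)]
  have "sep_inv S y \<in> sym_part R `` {sep_inv S x}" if "y \<in> sym_part R `` {x}" for y
    using that inv by (auto simp: sym_part_iff)
  moreover have "y \<in> sep_inv S ` (sym_part R `` {x})" if "y \<in> sym_part R `` {sep_inv S x}" for y
  proof (rule image_eqI)
    have y: "(sep_inv S x, y) \<in> R" "(y, sep_inv S x) \<in> R" using that by (auto simp: sym_part_iff)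
    show "y = sep_inv S (sep_inv S y)" using ii carrier y by metis
    show "sep_inv S y \<in> sym_part R `` {x}"
      using inv[OF y(1)] inv[OF y(2)] ii[OF assms(3)] by (simp add: sym_part_iff)
  qed
  ultimately show ?thesis by (auto simp: quotient_system_def)
qed

lemma quotient_system_tree_set:
  assumes tree: "tree_set S" and R: "tree_preorder S R"
  shows "tree_set (quotient_system S R)"
proof -
  let ?Q = "quotient_system S R" and ?c = "\<lambda>x. sym_part R `` {x}"
  have sep: "separation_system S" and pre: "sep_preorder S R"
    using tree R by (auto simp: tree_set_def tree_preorder_def)
  note le = quotient_system_le_iff[OF sep pre] and inv = quotient_system_inv[OF sep pre]
    and ic = sep_inv_carrier[OF sep]
  have eq: "?c x = ?c y \<longleftrightarrow> (x, y) \<in> sym_part R" if "x \<in> seps S" "y \<in> seps S" for x y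
    using eq_equiv_class_iff[OF sep_preorder_sym_part_equiv[OF sep pre] that] .
  have carrier: "seps ?Q = ?c ` seps S" by (auto simp: quotient_def)
  have sub: "sep_le ?Q \<subseteq> seps ?Q \<times> seps ?Q"
    using sep_preorder_carrier[OF pre] by (auto simp: quotient_system_def intro: quotientI)
  have "separation_system ?Q"
    unfolding separation_system_def partial_order_on_def preorder_on_def
  proof (intro conjI sub)
    show "refl_on (seps ?Q) (sep_le ?Q)"
      unfolding refl_on_def carrier by (auto simp: le sep_preorder_refl[OF sep pre])
    have rep: "\<exists>x\<in>seps S. A = ?c x" if "(A, B) \<in> sep_le ?Q \<or> (B, A) \<in> sep_le ?Q" for A B
      using sub that unfolding carrier by blast
    show "trans (sep_le ?Q)"
    proof (rule transI)
      fix A B C assume AB: "(A, B) \<in> sep_le ?Q" and BC: "(B, C) \<in> sep_le ?Q"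
      obtain x where x: "x \<in> seps S" "A = ?c x" using rep AB by blast
      obtain y where y: "y \<in> seps S" "B = ?c y" using rep AB by blast
      obtain z where z: "z \<in> seps S" "C = ?c z" using rep BC by blast
      have "(x, y) \<in> R" "(y, z) \<in> R" using AB BC x y z le by simp_all
      then show "(A, C) \<in> sep_le ?Q" using sep_preorder_trans[OF pre] x z le by simp
    qed
    show "antisym (sep_le ?Q)"
    proof (rule antisymI)
      fix A B assume AB: "(A, B) \<in> sep_le ?Q" and BA: "(B, A) \<in> sep_le ?Q"
      obtain x where x: "x \<in> seps S" "A = ?c x" using rep AB by blast
      obtain y where y: "y \<in> seps S" "B = ?c y" using rep AB by blast
      have "(x, y) \<in> sym_part R" using AB BA x y le by (simp add: sym_part_iff)
      then show "A = B" using x y eq by simp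
    qed
    show "sep_inv ?Q \<in> seps ?Q \<rightarrow> seps ?Q"
      unfolding carrier by (auto simp: inv ic)
    show "\<forall>A\<in>seps ?Q. sep_inv ?Q (sep_inv ?Q A) = A"
      unfolding carrier by (auto simp: inv ic sep_inv_inv[OF sep])
    show "\<forall>A\<in>seps ?Q. \<forall>B\<in>seps ?Q. (A, B) \<in> sep_le ?Q \<longrightarrow> (sep_inv ?Q B, sep_inv ?Q A) \<in> sep_le ?Q"
      unfolding carrier by (auto simp: inv ic le sep_preorder_inv[OF pre])
  qed
  moreover have "(?c r, ?c s) \<in> sep_le ?Q \<or> (?c r, ?c (sep_inv S s)) \<in> sep_le ?Q \<or>
      (?c (sep_inv S r), ?c s) \<in> sep_le ?Q \<or> (?c (sep_inv S r), ?c (sep_inv S s)) \<in> sep_le ?Q"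
    if "r \<in> seps S" "s \<in> seps S" for r s
  proof -
    have "(r, s) \<in> sep_le S \<or> (r, sep_inv S s) \<in> sep_le S \<or>
        (sep_inv S r, s) \<in> sep_le S \<or> (sep_inv S r, sep_inv S s) \<in> sep_le S"
      using tree that unfolding tree_set_iff by blast
    then show ?thesis using sep_preorder_le[OF pre] that ic le by meson
  qed
  moreover have "?c r \<noteq> ?c (sep_inv S r)" if "r \<in> seps S" for r
    using R that by (auto simp: eq ic tree_preorder_def)
  moreover have "?c r = ?c s \<or> ?c r = ?c (sep_inv S s)"
    if "r \<in> seps S" "s \<in> seps S" "(?c r, ?c s) \<in> sep_le ?Q" "(?c r, ?c (sep_inv S s)) \<in> sep_le ?Q" for r s
    using R that by (auto simp: le eq ic sym_part_iff tree_preorder_def)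
  ultimately show ?thesis
    unfolding tree_set_iff carrier by (simp add: inv)
qed

text \<open>By \<open>separating\<close>, the map to threads of classes reflects the order, which
  makes it injective and its inverse monotone; by \<open>complete\<close> it is surjective.\<close>

lemma (in quotient_family) isomorphic_inverse_limit_of_quotients:
  defines "leL \<equiv> {(L, M). L \<in> \<L> \<and> M \<in> \<L> \<and> M \<subseteq> L}"
    and "f \<equiv> \<lambda>(M :: 'a rel) L C. sym_part L `` C"
  assumes sys: "\<And>L. L \<in> \<L> \<Longrightarrow> separation_system (quotient_system S L)"
  shows "inverse_system \<L> leL (quotient_system S) f"
    and "isomorphic S (inverse_limit \<L> leL (quotient_system S) f)"
proof -
  note le = quotient_system_le_iff[OF sep preorder] and inv = quotient_system_inv[OF sep preorder]
    and ic = sep_inv_carrier[OF sep]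
  let ?c = "\<lambda>L x. sym_part L `` {x}"
  have carrier: "seps (quotient_system S L) = ?c L ` seps S" for L by (auto simp: quotient_def)
  have fc: "f M L (?c M x) = ?c L x" if "(L, M) \<in> leL" "x \<in> seps S" for L M x
  proof -
    have LM: "L \<in> \<L>" "M \<in> \<L>" "M \<subseteq> L" using that(1) by (auto simp: leL_def)
    then show ?thesis
      unfolding f_def using Image_class_coarser[OF equiv[OF LM(2)] _ sym_part_mono[OF LM(3)] that(2)]
        equiv[OF LM(1)] by (simp add: equiv_def)
  qed
  have hom: "sep_hom (quotient_system S M) (quotient_system S L) (f M L)" if LM: "(L, M) \<in> leL" for L M
  proof -
    have "L \<in> \<L>" "M \<in> \<L>" "M \<subseteq> L" using LM by (auto simp: leL_def)
    then show ?thesis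
      unfolding sep_hom_def carrier by (auto simp: fc[OF LM] inv le ic)
  qed
  show system: "inverse_system \<L> leL (quotient_system S) f"
    unfolding inverse_system_def
  proof (intro conjI allI impI ballI)
    show "directed_poset \<L> leL" unfolding leL_def by (rule directed_poset_reverse_inclusion)
    show "f L L C = C" if L: "L \<in> \<L>" and C: "C \<in> seps (quotient_system S L)" for L C
      using C fc[of L L] L unfolding carrier by (auto simp: leL_def)
    show "f M L (f N M C) = f N L C"
      if "(L, M) \<in> leL \<and> (M, N) \<in> leL" and C: "C \<in> seps (quotient_system S N)" for L M N C
    proof -
      have "(L, M) \<in> leL" "(M, N) \<in> leL" "(L, N) \<in> leL" using that(1) by (auto simp: leL_def)
      then show ?thesis using C unfolding carrier by (auto simp: fc)
    qed
  qed (use sys hom in auto)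
  let ?I = "inverse_limit \<L> leL (quotient_system S) f"
    and ?C = "compatible_families \<L> leL (quotient_system S) f"
  define \<phi> where "\<phi> x = (\<lambda>L\<in>\<L>. ?c L x)" for x
  have \<phi>C: "\<phi> x \<in> ?C" if "x \<in> seps S" for x
  proof -
    have "f M L (\<phi> x M) = \<phi> x L" if "(L, M) \<in> leL" for L M
      using fc[OF that \<open>x \<in> seps S\<close>] that by (auto simp: \<phi>_def leL_def)
    then show ?thesis using that by (auto simp: compatible_families_def \<phi>_def quotientI)
  qed
  have \<phi>le: "(\<phi> x, \<phi> y) \<in> sep_le ?I \<longleftrightarrow> (x, y) \<in> sep_le S" if "x \<in> seps S" "y \<in> seps S" for x y
  proof -
    have "(\<phi> x, \<phi> y) \<in> sep_le ?I \<longleftrightarrow> (\<forall>L\<in>\<L>. (x, y) \<in> L)"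
      using \<phi>C that by (simp add: \<phi>_def le)
    then show ?thesis using separating[OF that] sep_preorder_le[OF preorder] by blast
  qed
  have \<phi>inv: "\<phi> (sep_inv S x) = sep_inv ?I (\<phi> x)" if "x \<in> seps S" for x
    unfolding \<phi>_def inverse_limit_simps(3) by (rule restrict_ext) (simp add: inv that)
  have inj: "inj_on \<phi> (seps S)"
  proof (rule inj_onI)
    fix x y assume xy: "x \<in> seps S" "y \<in> seps S" "\<phi> x = \<phi> y"
    then show "x = y"
      using \<phi>le[OF xy(1,2)] \<phi>le[OF xy(2,1)] \<phi>le[OF xy(1,1)] sep_le_refl[OF sep xy(1)]
        sep_le_antisym[OF sep] by simp
  qed
  have surj: "\<exists>x\<in>seps S. \<phi> x = z" if z: "z \<in> ?C" for z
  proof -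
    have zL: "z L \<in> seps S // sym_part L" if "L \<in> \<L>" for L
      using z that by (auto simp: compatible_families_def)
    obtain x where x: "x \<in> seps S" "\<And>L. L \<in> \<L> \<Longrightarrow> z L = ?c L x"
    proof (rule complete_classes[of z])
      show "z M \<subseteq> z L" if LM: "L \<in> \<L>" "M \<in> \<L>" "M \<subseteq> L" for L M
      proof -
        have "sym_part L `` z M = z L" using z LM by (auto simp: compatible_families_def leL_def f_def)
        moreover have "z M \<subseteq> seps S" using in_quotient_imp_subset[OF equiv[OF LM(2)] zL[OF LM(2)]] .
        ultimately show ?thesis using equiv[OF LM(1)] by (fastforce simp: equiv_def refl_on_def)
      qed
    qed (use zL in auto)
    have "\<phi> x = z"
      by (rule compatible_families_eqI[OF \<phi>C[OF x(1)] z]) (simp add: \<phi>_def x(2))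
    then show ?thesis using x(1) by blast
  qed
  have bij: "bij_betw \<phi> (seps S) (seps ?I)"
    using inj \<phi>C surj by (fastforce simp: bij_betw_def)
  have hom1: "sep_hom S ?I \<phi>"
    unfolding sep_hom_def using \<phi>C \<phi>inv \<phi>le by auto
  have hom2: "sep_hom ?I S (inv_into (seps S) \<phi>)"
    unfolding sep_hom_def
  proof (intro conjI ballI impI)
    show "inv_into (seps S) \<phi> \<in> seps ?I \<rightarrow> seps S"
      using bij bij_betw_inv_into bij_betw_imp_funcset by blast
    fix s assume "s \<in> seps ?I"
    then obtain x where x: "x \<in> seps S" "s = \<phi> x" using surj by auto
    show "inv_into (seps S) \<phi> (sep_inv ?I s) = sep_inv S (inv_into (seps S) \<phi> s)"
      using inv_into_f_f[OF inj] x ic \<phi>inv by metis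
    fix t assume "t \<in> seps ?I" and le: "(s, t) \<in> sep_le ?I"
    then obtain y where y: "y \<in> seps S" "t = \<phi> y" using surj by auto
    show "(inv_into (seps S) \<phi> s, inv_into (seps S) \<phi> t) \<in> sep_le S"
      using inv_into_f_f[OF inj] x y le \<phi>le by metis
  qed
  show "isomorphic S ?I"
    unfolding isomorphic_def sep_iso_def using bij hom1 hom2 by blast
qed

theorem theorem1p1:
  "(\<forall>(P :: 'i set) leP (D :: 'i \<Rightarrow> 'b sep_system) f.
      inverse_system P leP D f \<and> (\<forall>p\<in>P. finite (seps (D p)) \<and> tree_set (D p))
      \<longrightarrow> tree_set (inverse_limit P leP D f)) \<and>
   (\<forall>T :: 'a sep_system.
      tree_set T \<and> profinite TYPE('j) TYPE('c) T \<longrightarrow>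
      (\<exists>(P :: ('a \<times> 'a) set set) leP (D :: ('a \<times> 'a) set \<Rightarrow> 'a set sep_system) f.
         inverse_system P leP D f \<and> (\<forall>p\<in>P. finite (seps (D p)) \<and> tree_set (D p)) \<and>
         isomorphic T (inverse_limit P leP D f)))"
proof (rule conjI; intro allI impI)
  fix P :: "'i set" and leP and D :: "'i \<Rightarrow> 'b sep_system" and f
  assume "inverse_system P leP D f \<and> (\<forall>p\<in>P. finite (seps (D p)) \<and> tree_set (D p))"
  then show "tree_set (inverse_limit P leP D f)" using inverse_limit_tree_set by blast
next
  fix T :: "'a sep_system"
  assume T: "tree_set T \<and> profinite TYPE('j) TYPE('c) T"
  then obtain \<L> where "quotient_family T \<L>" using profinite_imp_quotient_family by blast
  then interpret approx: quotient_family T \<L> .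
  define \<R> where "\<R> = {R. tree_preorder T R \<and> (\<exists>L\<in>\<L>. L \<subseteq> R)}"
  interpret quotient_family T \<R> unfolding \<R>_def using approx.tree_quotient_family T by blast
  have tree: "tree_set (quotient_system T R)" if "R \<in> \<R>" for R
    using quotient_system_tree_set T that unfolding \<R>_def by blast
  then have "separation_system (quotient_system T R)" if "R \<in> \<R>" for R
    using that by (simp add: tree_set_def)
  note limit = isomorphic_inverse_limit_of_quotients[OF this]
  show "\<exists>(P :: ('a \<times> 'a) set set) leP (D :: ('a \<times> 'a) set \<Rightarrow> 'a set sep_system) f.
         inverse_system P leP D f \<and> (\<forall>p\<in>P. finite (seps (D p)) \<and> tree_set (D p)) \<and>
         isomorphic T (inverse_limit P leP D f)"
    using limit tree fin by (intro exI conjI ballI) auto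
qed

end
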